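(* Let $\alpha\ge 1$ be an integer. If $D$ is a $C_3$-free digraph with $\alpha(D)\le\alpha$, then $\chi(D)\le 35^{\alpha-1}\alpha!$, and a partition of $V(D)$ into at most $35^{\alpha-1}\alpha!$ acyclic sets can be found in polynomial time.
   Context: All digraphs are finite, loopless and simple (for every two vertices $u,v$ there is at most one arc with endpoints $\{u,v\}$; in particular no directed 2-cycles). $C_3$ is the directed (oriented) triangle, and $D$ is $C_3$-free if no induced subgraph of $D$ is isomorphic to $C_3$. The independence number $\alpha(D)$ is the independence number of the underlying undirected graph of $D$. A set $X\subseteq V(D)$ is acyclic if the subgraph induced by $X$ contains no directed cycle. The chromatic number $\chi(D)$ is the minimum number $k$ such that $V(D)$ can be partitioned into $k$ acyclic sets; such a partition is a $k$-coloring. "Polynomial time" means time bounded by a polynomial depending only on the number of vertices $n=|V(D)|$ (with exponent not depending on $\alpha$). *)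

theory Defs
  imports
    "Graph_Theory.Graph_Theory"
    "HOL-Library.Disjoint_Sets"
    "HOL-Computational_Algebra.Polynomial"
begin

section \<open>Oriented digraphs, independence number, dichromatic number\<close>

text \<open>The library locale \<^locale>\<open>digraph\<close> (finite, loopless, no parallel arcs) still allows
  directed 2-cycles.\<close>

locale oriented_digraph = digraph +
  assumes no_2cycle: "u \<rightarrow> v \<Longrightarrow> \<not> v \<rightarrow> u"

definition C3 :: "(nat, nat \<times> nat) pre_digraph" where
  "C3 = \<lparr> verts = {0, 1, 2}, arcs = {(0, 1), (1, 2), (2, 0)}, tail = fst, head = snd \<rparr>"

definition C3_free :: "('a, 'b) pre_digraph \<Rightarrow> bool" where
  "C3_free D \<longleftrightarrow> \<not> (\<exists>H. induced_subgraph H D \<and> digraph_iso H C3)"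

text \<open>\<^const>\<open>mk_symmetric\<close> is the library's rendering of the underlying undirected graph.\<close>

definition independent_set :: "('a, 'b) pre_digraph \<Rightarrow> 'a set \<Rightarrow> bool" where
  "independent_set D S \<longleftrightarrow>
     S \<subseteq> verts D \<and> (\<forall>u\<in>S. \<forall>v\<in>S. \<not> u \<rightarrow>\<^bsub>mk_symmetric D\<^esub> v)"

definition independence_number :: "('a, 'b) pre_digraph \<Rightarrow> nat" where
  "independence_number D = Max {card S | S. independent_set D S}"

definition acyclic_set :: "('a, 'b) pre_digraph \<Rightarrow> 'a set \<Rightarrow> bool" where
  "acyclic_set D X \<longleftrightarrow> X \<subseteq> verts D \<and> \<not> (\<exists>p. pre_digraph.cycle (D \<restriction> X) p)"

definition acyclic_partition :: "('a, 'b) pre_digraph \<Rightarrow> 'a set set \<Rightarrow> bool" where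
  "acyclic_partition D P \<longleftrightarrow> partition_on (verts D) P \<and> (\<forall>X\<in>P. acyclic_set D X)"

definition chromatic_number :: "('a, 'b) pre_digraph \<Rightarrow> nat" where
  "chromatic_number D = (LEAST k. \<exists>P. acyclic_partition D P \<and> card P = k)"

section \<open>Model of computation\<close>

text \<open>Structured programs for a random access machine whose memory is organised in named arrays of
  natural numbers (a program mentions finitely many names; a scalar variable is cell 0 of an array).
  Every elementary operation has unit cost. The only arithmetic operations are addition and
  truncated subtraction, so the bit length of a number grows by at most a constant per step;
  this is what makes polynomial time in this model the same as polynomial time on Turing machines
  (unit-cost multiplication would break it).\<close>

type_synonym vname = string
type_synonym state = "vname \<Rightarrow> nat \<Rightarrow> nat"

datatype expr =
    Const nat
  | Cell vname expr
  | Plus expr expr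
  | Minus expr expr

fun eval_expr :: "expr \<Rightarrow> state \<Rightarrow> nat" where
  "eval_expr (Const k) s = k"
| "eval_expr (Cell x e) s = s x (eval_expr e s)"
| "eval_expr (Plus e1 e2) s = eval_expr e1 s + eval_expr e2 s"
| "eval_expr (Minus e1 e2) s = eval_expr e1 s - eval_expr e2 s"

fun expr_cost :: "expr \<Rightarrow> nat" where
  "expr_cost (Const k) = 1"
| "expr_cost (Cell x e) = expr_cost e + 1"
| "expr_cost (Plus e1 e2) = expr_cost e1 + expr_cost e2 + 1"
| "expr_cost (Minus e1 e2) = expr_cost e1 + expr_cost e2 + 1"

text \<open>\<open>Assign x i e\<close> stores the value of \<open>e\<close> in cell \<open>i\<close> of array \<open>x\<close>. A guard holds iff its
  value is nonzero; for instance \<open>a < b\<close> is the guard \<open>Minus b a\<close>.\<close>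

datatype com =
    Skip
  | Assign vname expr expr
  | Seq com com
  | If expr com com
  | While expr com

text \<open>\<open>exec c s t s'\<close>: program \<open>c\<close>, started in state \<open>s\<close>, halts after exactly \<open>t\<close> steps in
  state \<open>s'\<close>.\<close>

inductive exec :: "com \<Rightarrow> state \<Rightarrow> nat \<Rightarrow> state \<Rightarrow> bool" where
  Skip: "exec Skip s 1 s"
| Assign: "exec (Assign x i e) s (expr_cost i + expr_cost e + 1)
      (s(x := (s x)(eval_expr i s := eval_expr e s)))"
| Seq: "exec c1 s1 t1 s2 \<Longrightarrow> exec c2 s2 t2 s3 \<Longrightarrow> exec (Seq c1 c2) s1 (t1 + t2) s3"
| IfTrue: "eval_expr b s \<noteq> 0 \<Longrightarrow> exec c1 s t s' \<Longrightarrow>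
      exec (If b c1 c2) s (expr_cost b + t + 1) s'"
| IfFalse: "eval_expr b s = 0 \<Longrightarrow> exec c2 s t s' \<Longrightarrow>
      exec (If b c1 c2) s (expr_cost b + t + 1) s'"
| WhileFalse: "eval_expr b s = 0 \<Longrightarrow> exec (While b c) s (expr_cost b + 1) s"
| WhileTrue: "eval_expr b s1 \<noteq> 0 \<Longrightarrow> exec c s1 t1 s2 \<Longrightarrow> exec (While b c) s2 t2 s3 \<Longrightarrow>
      exec (While b c) s1 (expr_cost b + t1 + t2 + 1) s3"

text \<open>Input encoding of a digraph with vertex set \<open>{0, ..., n - 1}\<close> and a number \<open>\<alpha>\<close>: the scalars
  \<open>n\<close> and \<open>alpha\<close>, and the adjacency matrix stored row by row. All other memory is zero.\<close>

definition input_state :: "(nat, 'b) pre_digraph \<Rightarrow> nat \<Rightarrow> nat \<Rightarrow> state" where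
  "input_state D n \<alpha> = (\<lambda>x i. 0)
     (''n'' := (\<lambda>i. if i = 0 then n else 0),
      ''alpha'' := (\<lambda>i. if i = 0 then \<alpha> else 0),
      ''adj'' := (\<lambda>i. if i < n * n \<and> (i div n) \<rightarrow>\<^bsub>D\<^esub> (i mod n) then 1 else 0))"

text \<open>Output encoding: cell \<open>v\<close> of the array \<open>colour\<close> names the class of vertex \<open>v\<close>.\<close>

definition output_partition :: "nat \<Rightarrow> state \<Rightarrow> nat set set" where
  "output_partition n s = {{v \<in> {..<n}. s ''colour'' v = s ''colour'' u} | u. u < n}"

end

theory Submission
  imports Defs
begin

text \<open>
  The classes of a colouring are refined until they are acyclic. Let \<open>K\<close> be a strong component of a
  colour class, let \<open>a \<ge> 2\<close> be its independence number, let \<open>r \<in> K\<close>, and split \<open>K\<close> into layers by the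
  distance from \<open>r\<close>. An arc raises this distance by at most one. Among vertices whose distances have
  equal parity no arc raises it at all, and so a strong component of such a set lies in one layer.

  Let \<open>X\<close> be a layer at distance at least two. By Chvatal and Lovasz it has a quasi-kernel: an
  independent set \<open>Q \<subseteq> X\<close> from which every vertex of \<open>X\<close> is reached by a path with at most two arcs.
  There are no directed triangles, so every \<open>x \<in> X\<close> has some \<open>t \<in> Q\<close> that \<open>x\<close> does not dominate. Let
  \<open>q' \<rightarrow> q \<rightarrow> t\<close> be the end of a shortest path from \<open>r\<close> to \<open>t\<close>. Suppose that \<open>x\<close> is adjacent to \<open>t\<close> and
  to \<open>q\<close>. Then \<open>t \<rightarrow> x\<close>; the triangle on \<open>q, t, x\<close> is excluded, so \<open>q \<rightarrow> x\<close>; the triangle on \<open>q', q, x\<close> is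
  excluded, so \<open>x\<close> does not dominate \<open>q'\<close>; and \<open>q'\<close> does not dominate \<open>x\<close>, because \<open>x\<close> would be too
  close to \<open>r\<close>. Hence \<open>x\<close> is nonadjacent to one of \<open>t\<close>, \<open>q\<close>, \<open>q'\<close> (lemma \<open>witness_kind_nonadj\<close>). So \<open>X\<close>
  is covered by \<open>3 |Q| \<le> 3 a\<close> sets, each of which, up to a vertex \<open>t\<close> that is isolated in it, consists
  of non-neighbours of one vertex of \<open>K\<close>. Adding that vertex to an independent set of its
  non-neighbours shows that all strong components of these sets have independence number at most
  \<open>a - 1\<close> (lemma \<open>independence_drop\<close>).

  The argument needs two steps back from \<open>t\<close> and fails for the out-neighbours of \<open>r\<close>. These are at
  distance at least two in the reversed digraph, as there are no 2-cycles, and are treated there. Two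
  directions, two parities and \<open>3 a\<close> sets per layer make \<open>12 a\<close> labels (lemma
  \<open>refinement_round\<close>). A strong component with independence number one is a single vertex (lemma
  \<open>scc_trivial\<close>), so the rounds end with acyclic classes, and the number of colours is at most
  \<open>12 a \<cdot> 12 (a - 1) \<cdots> 12 \<cdot> 2 = 12^(a - 1) a!\<close>, where now \<open>a\<close> is the independence number of the digraph.

  Everything in a round is computable by breadth-first search and two greedy scans, for all
  components of all colour classes in the same round. There is thus no recursion whose branching
  could bring \<open>\<alpha>\<close> into the exponent of the running time, and the program does not read \<open>\<alpha>\<close>: it performs
  \<open>n\<close> rounds, since a round leaves a partition into acyclic classes as it is. The program is
  written in a small language in which every loop has exactly \<open>n\<close> iterations, so that a compiler can be
  verified once for both results and polynomial running time (lemmas \<open>compile_correct\<close> and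
  \<open>prog_time_poly\<close>). The bound on the chromatic number of an arbitrary digraph follows by running the
  program on a copy of the digraph with vertices \<open>0, \<dots>, n - 1\<close>.
\<close>

section \<open>Strong components, levels and quasi-kernels\<close>

definition scc :: "('a \<times> 'a) set \<Rightarrow> 'a \<Rightarrow> 'a set" where
  "scc E r = {v. (r, v) \<in> E\<^sup>* \<and> (v, r) \<in> E\<^sup>*}"

definition indep :: "('a \<times> 'a) set \<Rightarrow> 'a set \<Rightarrow> bool" where
  "indep E S \<longleftrightarrow> (\<forall>u\<in>S. \<forall>v\<in>S. (u, v) \<notin> E)"

abbreviation nonadj :: "('a \<times> 'a) set \<Rightarrow> 'a \<Rightarrow> 'a \<Rightarrow> bool" where
  "nonadj E u v \<equiv> (u, v) \<notin> E \<and> (v, u) \<notin> E"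

text \<open>Excluding 2-cycles as well as triangles keeps the case analysis on adjacency symmetric: both conditions
pass to subrelations and to the converse relation.\<close>

definition C3_free_rel :: "('a \<times> 'a) set \<Rightarrow> bool" where
  "C3_free_rel E \<longleftrightarrow> asym E \<and> (\<forall>u v w. (u, v) \<in> E \<longrightarrow> (v, w) \<in> E \<longrightarrow> (w, u) \<notin> E)"

lemma C3_free_relD:
  assumes "C3_free_rel E"
  shows "(u, u) \<notin> E" "(u, v) \<in> E \<Longrightarrow> (v, u) \<notin> E" "(u, v) \<in> E \<Longrightarrow> (v, w) \<in> E \<Longrightarrow> (w, u) \<notin> E"
  using assms unfolding C3_free_rel_def asym_iff by blast+

lemma C3_free_rel_converse: "C3_free_rel E \<Longrightarrow> C3_free_rel (E\<inverse>)"
  unfolding C3_free_rel_def asym_iff by blast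

lemma C3_free_rel_subset: "C3_free_rel E \<Longrightarrow> F \<subseteq> E \<Longrightarrow> C3_free_rel F"
  unfolding C3_free_rel_def asym_iff by blast

lemma indep_converse [simp]: "indep (E\<inverse>) S = indep E S"
  by (auto simp: indep_def)

lemma scc_converse [simp]: "scc (E\<inverse>) r = scc E r"
  by (auto simp: scc_def rtrancl_converse)

lemma scc_refl [simp]: "r \<in> scc E r"
  by (simp add: scc_def)

lemma scc_eq: "v \<in> scc E r \<Longrightarrow> scc E v = scc E r"
  unfolding scc_def by (auto intro: rtrancl_trans)

lemma scc_path:
  assumes "u \<in> scc E r" "v \<in> scc E r" "(u, w) \<in> E\<^sup>*" "(w, v) \<in> E\<^sup>*"
  shows "w \<in> scc E r"
  using assms unfolding scc_def by (auto intro: rtrancl_trans)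

lemma scc_mono: "F \<subseteq> E \<Longrightarrow> scc F r \<subseteq> scc E r"
  unfolding scc_def using rtrancl_mono by blast

text \<open>All vertices of the component are adjacent. Along a path from \<open>r\<close> every vertex is then dominated by
\<open>r\<close>: otherwise the first exception would close a triangle. But some arc of the component enters \<open>r\<close>
if there is a second vertex.\<close>

lemma scc_trivial:
  assumes free: "C3_free_rel E"
    and small: "\<And>S. finite S \<Longrightarrow> S \<subseteq> scc E r \<Longrightarrow> indep E S \<Longrightarrow> card S \<le> 1"
  shows "scc E r = {r}"
proof -
  have adj: "(u, v) \<in> E \<or> (v, u) \<in> E" if "u \<in> scc E r" "v \<in> scc E r" "u \<noteq> v" for u v
    using small[of "{u, v}"] that C3_free_relD(1)[OF free] by (auto simp: indep_def)
  have dominated: "v = r \<or> (r, v) \<in> E" if "(r, v) \<in> E\<^sup>*" "(v, r) \<in> E\<^sup>*" for v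
    using that
  proof (induction rule: rtrancl_induct)
    case (step v w)
    have w: "w \<in> scc E r" using step by (auto simp: scc_def intro: rtrancl_into_rtrancl)
    have "(v, r) \<in> E\<^sup>*" using step by (meson converse_rtrancl_into_rtrancl)
    then consider "v = r" | "(r, v) \<in> E" using step.IH by blast
    then show ?case
      using adj[OF scc_refl w] C3_free_relD(3)[OF free _ step.hyps(2)] step.hyps(2) by cases blast+
  qed simp
  have False if "v \<in> scc E r" and vr: "v \<noteq> r" for v
  proof -
    have "(v, r) \<in> E\<^sup>*" using that by (simp add: scc_def)
    then obtain u where u: "(v, u) \<in> E\<^sup>*" "(u, r) \<in> E"
      by (cases rule: rtranclE) (use vr in simp, rule that)
    then have "u \<in> scc E r" using scc_path[OF \<open>v \<in> scc E r\<close> scc_refl u(1) r_into_rtrancl[OF u(2)]] by simp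
    then have "u = r \<or> (r, u) \<in> E" using dominated by (auto simp: scc_def)
    then show False using u C3_free_relD(1,2)[OF free] by blast
  qed
  then show ?thesis using scc_refl by fastforce
qed

text \<open>The intended function is \<open>n + 1\<close> minus the distance from \<open>r\<close>, with truncated subtraction and \<open>0\<close> for
unreachable vertices. Counting downwards gives unreachable vertices the default value of a memory
cell and makes a level computable by counting the rounds since a vertex was found. Level \<open>n\<close> holds the
out-neighbours of \<open>r\<close>, and a predecessor on a shortest path is one level higher.\<close>

definition is_level :: "('a \<times> 'a) set \<Rightarrow> nat \<Rightarrow> 'a \<Rightarrow> ('a \<Rightarrow> nat) \<Rightarrow> bool" where
  "is_level E n r f \<longleftrightarrow> f r = Suc n \<and> (\<forall>v. v \<noteq> r \<longrightarrow> f v \<le> n) \<and> (\<forall>v. 0 < f v \<longleftrightarrow> (r, v) \<in> E\<^sup>*) \<and>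
     (\<forall>u v. (u, v) \<in> E \<longrightarrow> f u \<le> Suc (f v)) \<and>
     (\<forall>v. 0 < f v \<longrightarrow> v \<noteq> r \<longrightarrow> (\<exists>u. (u, v) \<in> E \<and> f u = Suc (f v)))"

lemma is_levelD:
  assumes "is_level E n r f"
  shows "f r = Suc n" "v \<noteq> r \<Longrightarrow> f v \<le> n" "0 < f v \<longleftrightarrow> (r, v) \<in> E\<^sup>*" "(u, v) \<in> E \<Longrightarrow> f u \<le> Suc (f v)"
    "0 < f v \<Longrightarrow> v \<noteq> r \<Longrightarrow> \<exists>u. (u, v) \<in> E \<and> f u = Suc (f v)"
  using assms unfolding is_level_def by auto

text \<open>The construction of Chvatal and Lovasz as two greedy scans. The ascending scan \<open>S\<close> picks a vertex
unless a picked vertex dominates it, so arcs inside \<open>S\<close> only go down in the order; the descending scan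
\<open>Q\<close> of \<open>S\<close> does the same and therefore leaves no arc in either direction. A vertex outside \<open>Q\<close> is
reached from \<open>Q\<close> by one or two arcs, and an arc back to the starting point would close a
2-cycle or a triangle.\<close>

lemma quasi_kernel:
  fixes X :: "'a :: linorder set"
  assumes free: "C3_free_rel E"
    and S: "\<And>v. v \<in> X \<Longrightarrow> v \<in> S \<longleftrightarrow> \<not> (\<exists>u\<in>S \<inter> X. u < v \<and> (u, v) \<in> E)"
    and Q: "\<And>v. v \<in> X \<Longrightarrow> v \<in> Q \<longleftrightarrow> v \<in> S \<and> \<not> (\<exists>u\<in>Q \<inter> X. v < u \<and> (u, v) \<in> E)"
  shows "indep E (Q \<inter> X)" "x \<in> X \<Longrightarrow> \<exists>t\<in>Q \<inter> X. (x, t) \<notin> E"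
proof -
  have "(u, v) \<notin> E" if "u \<in> Q \<inter> X" "v \<in> Q \<inter> X" for u v
  proof (cases u v rule: linorder_cases)
    case less then show ?thesis using S[of v] Q[of u] Q[of v] that by blast
  next
    case equal then show ?thesis using C3_free_relD(1)[OF free] by simp
  next
    case greater then show ?thesis using Q[of v] that by blast
  qed
  then show "indep E (Q \<inter> X)" by (auto simp: indep_def)
  assume x: "x \<in> X"
  have from_S: "\<exists>t\<in>Q \<inter> X. t = y \<or> (t, y) \<in> E" if "y \<in> S \<inter> X" for y
    using Q[of y] that by blast
  obtain y where y: "y \<in> S \<inter> X" "y = x \<or> (y, x) \<in> E" using S[OF x] x by blast
  then obtain t where t: "t \<in> Q \<inter> X" "t = y \<or> (t, y) \<in> E" using from_S by blast
  have "(x, t) \<notin> E" using y(2) t(2) C3_free_relD[OF free] by blast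
  then show "\<exists>t\<in>Q \<inter> X. (x, t) \<notin> E" using t(1) by blast
qed

definition layer :: "('a \<times> 'a) set \<Rightarrow> 'a \<Rightarrow> ('a \<Rightarrow> nat) \<Rightarrow> 'a \<Rightarrow> 'a set" where
  "layer E r f x = {v \<in> scc E r. f v = f x}"

text \<open>The number of steps back from \<open>t\<close> along the parent function \<open>p\<close> after which a vertex nonadjacent to \<open>x\<close>
is found. The value 2 is the remaining case; that it is found there is \<open>witness_kind_nonadj\<close>.\<close>

definition witness_kind :: "('a \<times> 'a) set \<Rightarrow> ('a \<Rightarrow> 'a) \<Rightarrow> 'a \<Rightarrow> 'a \<Rightarrow> nat" where
  "witness_kind E p t x = (if nonadj E x t then 0 else if nonadj E x (p t) then 1 else 2)"

text \<open>The data computed for the component of \<open>r\<close> in one direction: levels \<open>f\<close>, parents \<open>p\<close> towards \<open>r\<close>,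
the union \<open>Q\<close> of quasi-kernels of all layers, and for each vertex a vertex \<open>wit x\<close> of the quasi-kernel
of its layer that it does not dominate.\<close>

definition pass_ok :: "('a \<times> 'a) set \<Rightarrow> nat \<Rightarrow> 'a \<Rightarrow> ('a \<Rightarrow> nat) \<Rightarrow> ('a \<Rightarrow> 'a) \<Rightarrow> 'a set \<Rightarrow> ('a \<Rightarrow> 'a) \<Rightarrow> bool" where
  "pass_ok E n r f p Q wit \<longleftrightarrow> is_level E n r f \<and>
     (\<forall>v\<in>scc E r. v \<noteq> r \<longrightarrow> (p v, v) \<in> E \<and> f (p v) = Suc (f v)) \<and>
     (\<forall>x\<in>scc E r. indep E (Q \<inter> layer E r f x) \<and> finite (layer E r f x) \<and>
        wit x \<in> Q \<inter> layer E r f x \<and> (x, wit x) \<notin> E)"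

text \<open>The witness \<open>wit x\<close> is recorded as its rank in the quasi-kernel of the layer, which is less than the
independence number; the name of the vertex itself would use up too many labels. The bit of weight one
is left free for the direction.\<close>

definition pass_label :: "('a \<times> 'a) set \<Rightarrow> 'a \<Rightarrow> ('a \<Rightarrow> nat) \<Rightarrow> ('a \<Rightarrow> 'a) \<Rightarrow> 'a set \<Rightarrow> ('a \<Rightarrow> 'a :: linorder) \<Rightarrow> 'a \<Rightarrow> nat" where
  "pass_label E r f p Q wit x =
     12 * card {t \<in> Q \<inter> layer E r f x. t < wit x} + 4 * witness_kind E p (wit x) x + 2 * (f x mod 2)"

lemma witness_kind_le: "witness_kind E p t x \<le> 2"
  by (simp add: witness_kind_def)

lemma pass_label_eqD:
  assumes "pass_label E r f p Q wit x + i = pass_label E r f p Q wit y + j" "i < 2" "j < 2"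
  shows "i = j" "f x mod 2 = f y mod 2" "witness_kind E p (wit x) x = witness_kind E p (wit y) y"
    "card {t \<in> Q \<inter> layer E r f x. t < wit x} = card {t \<in> Q \<inter> layer E r f y. t < wit y}"
proof -
  \<comment> \<open>a label is a number in the mixed radix system with digits below 2, 2, 3 and the rank on top\<close>
  have dec: "a = b \<and> w = w' \<and> m = m' \<and> i = j"
    if "12 * a + 4 * w + 2 * m + i = 12 * b + 4 * w' + 2 * m' + j"
      "w \<le> 2" "w' \<le> 2" "m < 2" "m' < 2" "i < 2" "j < (2::nat)" for a b w w' m m' :: nat
  proof -
    have two: "x = y \<and> u = v" if "2 * x + u = 2 * y + v" "u < 2" "v < 2" for x y u v :: nat
      using that by presburger
    have three: "x = y \<and> u = v" if "3 * x + u = 3 * y + v" "u \<le> 2" "v \<le> 2" for x y u v :: nat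
      using that by presburger
    have "2 * (2 * (3 * a + w) + m) + i = 2 * (2 * (3 * b + w') + m') + j" using that(1) by simp
    then have "2 * (3 * a + w) + m = 2 * (3 * b + w') + m'" "i = j" using two that(6,7) by blast+
    moreover from this have "3 * a + w = 3 * b + w'" "m = m'" using two that(4,5) by blast+
    ultimately show ?thesis using three that(2,3) by blast
  qed
  show "i = j" "f x mod 2 = f y mod 2" "witness_kind E p (wit x) x = witness_kind E p (wit y) y"
    "card {t \<in> Q \<inter> layer E r f x. t < wit x} = card {t \<in> Q \<inter> layer E r f y. t < wit y}"
    using dec[OF assms(1)[unfolded pass_label_def] witness_kind_le witness_kind_le _ _ assms(2,3)]
    by simp_all
qed

lemma initial_segment_card_inj:
  fixes a b :: "'a :: linorder"
  assumes "finite W" "a \<in> W" "b \<in> W" "card {t\<in>W. t < a} = card {t\<in>W. t < b}"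
  shows "a = b"
proof -
  have "card {t\<in>W. t < x} < card {t\<in>W. t < y}" if "x < y" "x \<in> W" for x y
  proof (rule psubset_card_mono)
    show "finite {t\<in>W. t < y}" using assms(1) by simp
    have "{t\<in>W. t < x} \<subseteq> {t\<in>W. t < y}" using that(1) by (blast intro: less_trans)
    moreover have "x \<in> {t\<in>W. t < y}" "x \<notin> {t\<in>W. t < x}" using that by simp_all
    ultimately show "{t\<in>W. t < x} \<subset> {t\<in>W. t < y}" by blast
  qed
  then show ?thesis using assms(2-4) by (cases a b rule: linorder_cases) fastforce+
qed

text \<open>The covering argument. Level \<open>n\<close>, the out-neighbourhood of \<open>r\<close>, is excluded because a witness there has
\<open>r\<close> as its parent and hence no grandparent.\<close>

lemma witness_kind_nonadj:
  assumes free: "C3_free_rel E" and ok: "pass_ok E n r f p Q wit"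
    and x: "x \<in> scc E r" "f x \<noteq> n"
  shows "\<exists>q\<in>scc E r. nonadj E x q \<and>
    q = (if witness_kind E p (wit x) x = 0 then wit x
         else if witness_kind E p (wit x) x = 1 then p (wit x) else p (p (wit x))) \<and>
    (witness_kind E p (wit x) x \<noteq> 0 \<longrightarrow> f q \<noteq> f x)"
proof (cases "nonadj E x (wit x)")
  case True
  then show ?thesis using ok x(1) by (auto simp: witness_kind_def pass_ok_def layer_def)
next
  case False
  define t where "t = wit x"
  have lev: "is_level E n r f" using ok by (simp add: pass_ok_def)
  have t: "t \<in> scc E r" "f t = f x" "(x, t) \<notin> E"
    using ok x(1) by (auto simp: pass_ok_def layer_def t_def)
  have tx: "(t, x) \<in> E" using False t(3) by (simp add: t_def)
  have par: "(p v, v) \<in> E" "f (p v) = Suc (f v)" "p v \<in> scc E r" if "v \<in> scc E r" "v \<noteq> r" for v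
  proof -
    show 1: "(p v, v) \<in> E" "f (p v) = Suc (f v)" using ok that by (auto simp: pass_ok_def)
    from 1(2) have "0 < f (p v)" by simp
    then have "(r, p v) \<in> E\<^sup>*" by (rule iffD1[OF is_levelD(3)[OF lev]])
    then show "p v \<in> scc E r" by (rule scc_path[OF scc_refl that(1) _ r_into_rtrancl[OF 1(1)]])
  qed
  have tr: "t \<noteq> r"
    using is_levelD(1)[OF lev] is_levelD(2)[OF lev, of x] t(2) tx C3_free_relD(1)[OF free, of r]
    by (cases "x = r") auto
  note q1 = par[OF t(1) tr]
  have "f t \<le> n" using is_levelD(2)[OF lev tr] .
  then have q1r: "p t \<noteq> r" using q1(2) x(2) t(2) is_levelD(1)[OF lev] by auto
  note q2 = par[OF q1(3) q1r]
  show ?thesis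
  proof (cases "nonadj E x (p t)")
    case True
    then show ?thesis using False q1 t(2) by (intro bexI[of _ "p t"]) (auto simp: witness_kind_def t_def)
  next
    case adj: False
    \<comment> \<open>if \<open>x\<close> is adjacent to the parent, the arc comes from the parent, which excludes an arc from \<open>x\<close> to the
      grandparent; the opposite arc would put \<open>x\<close> on a level above that of \<open>t\<close>\<close>
    have "(x, p t) \<notin> E" using C3_free_relD(3)[OF free q1(1) tx] by blast
    then have "(p t, x) \<in> E" using adj by simp
    then have "(x, p (p t)) \<notin> E" using C3_free_relD(3)[OF free q2(1)] by blast
    moreover have "(p (p t), x) \<notin> E"
      using is_levelD(4)[OF lev, of "p (p t)" x] q1(2) q2(2) t(2) by auto
    ultimately show ?thesis using False adj q1 q2 t(2)
      by (intro bexI[of _ "p (p t)"]) (auto simp: witness_kind_def t_def)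
  qed
qed

text \<open>An arc lowers the level by at most one, and lowering it by exactly one would change the parity.\<close>

lemma level_mono_on_parity_class:
  assumes lev: "is_level E n r f" and F: "F \<subseteq> E" "\<And>u v. (u, v) \<in> F \<Longrightarrow> f u mod 2 = f v mod 2"
    and "(u, v) \<in> F\<^sup>*"
  shows "f u \<le> f v"
  using assms(4)
proof (induction rule: rtrancl_induct)
  case (step v w)
  have "f v \<le> Suc (f w)" "f v mod 2 = f w mod 2"
    using is_levelD(4)[OF lev, of v w] F step.hyps(2) by auto
  then have "f v \<le> f w" by presburger
  then show ?case using step.IH by simp
qed simp

text \<open>All vertices of the new component are nonadjacent to the same vertex \<open>q\<close> of the old component. If \<open>q\<close>
is not in the new component, it can be added to every independent set. If it is, then it is the
common witness; no arc joins it to the rest of the new component, which therefore consists of \<open>q\<close>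
alone. This exceptional case is the reason for the maximum with one.\<close>

lemma independence_drop:
  assumes free: "C3_free_rel E" and ok: "pass_ok E n r f p Q wit"
    and bound: "\<And>S. finite S \<Longrightarrow> S \<subseteq> scc E r \<Longrightarrow> indep E S \<Longrightarrow> card S \<le> a"
    and F: "F \<subseteq> E" and v: "v \<in> scc E r"
    and same: "\<And>x. x \<in> scc F v \<Longrightarrow> f x = f v \<and> wit x = wit v \<and>
      witness_kind E p (wit x) x = witness_kind E p (wit v) v"
    and nv: "f v \<noteq> n"
    and S: "finite S" "S \<subseteq> scc F v" "indep E S"
  shows "card S \<le> max 1 (a - 1)"
proof -
  have sub: "scc F v \<subseteq> scc E r" using scc_mono[OF F, of v] scc_eq[OF v] by simp
  define q where "q = (if witness_kind E p (wit v) v = 0 then wit v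
         else if witness_kind E p (wit v) v = 1 then p (wit v) else p (p (wit v)))"
  have q: "q \<in> scc E r" "nonadj E x q" "witness_kind E p (wit v) v \<noteq> 0 \<longrightarrow> f q \<noteq> f x"
    if "x \<in> scc F v" for x
    using witness_kind_nonadj[OF free ok, of x] sub that same[OF that] nv unfolding q_def by auto
  show ?thesis
  proof (cases "q \<in> scc F v")
    case True
    then have k0: "witness_kind E p (wit v) v = 0" using q(3)[OF True] by blast
    have "x = q" if "x \<in> scc F v" for x
    proof (rule ccontr)
      assume "x \<noteq> q"
      have "(q, x) \<in> F\<^sup>*" using that scc_eq[OF True] by (auto simp: scc_def)
      then obtain y where y: "(q, y) \<in> F" "(y, x) \<in> F\<^sup>*"
        by (cases rule: converse_rtranclE) (use \<open>x \<noteq> q\<close> in simp, rule that)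
      have "y \<in> scc F v" by (rule scc_path[OF True that r_into_rtrancl[OF y(1)] y(2)])
      then show False using q(2) y(1) F by blast
    qed
    then have "S \<subseteq> {q}" using S(2) by auto
    then have "card S \<le> 1" using card_mono[of "{q}" S] by simp
    then show ?thesis by simp
  next
    case False
    have "indep E (insert q S)"
      using S q(2) C3_free_relD(1)[OF free] by (fastforce simp: indep_def)
    moreover have "insert q S \<subseteq> scc E r" using S(2) sub q(1)[of v] by auto
    ultimately have "card (insert q S) \<le> a" using bound S(1) by simp
    moreover have "q \<notin> S" using False S(2) by auto
    ultimately show ?thesis using S(1) by simp
  qed
qed

text \<open>A label determines only the parity of the level and the rank of the witness. Inside a strong component
of a label class the level is constant, and within one layer the rank determines the witness.\<close>

lemma same_label_pass:
  assumes lev: "pass_ok E n r f p Q wit" and F: "F \<subseteq> E"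
    and lab: "\<And>x y. (x, y) \<in> F \<Longrightarrow> pass_label E r f p Q wit x = pass_label E r f p Q wit y"
    and v: "v \<in> scc E r" and x: "x \<in> scc F v"
    and eq: "pass_label E r f p Q wit x = pass_label E r f p Q wit v"
  shows "f x = f v \<and> wit x = wit v \<and> witness_kind E p (wit x) x = witness_kind E p (wit v) v"
proof -
  have l: "is_level E n r f" using lev by (simp add: pass_ok_def)
  have par: "f u mod 2 = f w mod 2" if "(u, w) \<in> F" for u w
    using pass_label_eqD(2)[of E r f p Q wit u 0 w 0] lab[OF that] by simp
  have fx: "f x = f v"
    using level_mono_on_parity_class[OF l F par] x by (auto simp: scc_def intro!: antisym)
  have xr: "x \<in> scc E r" using x scc_mono[OF F] scc_eq[OF v] by blast
  have lx: "layer E r f x = layer E r f v" using fx by (simp add: layer_def)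
  have "wit x = wit v"
    using pass_label_eqD(4)[of E r f p Q wit x 0 v 0] eq lev v xr
    by (intro initial_segment_card_inj[of "Q \<inter> layer E r f v"]) (auto simp: pass_ok_def lx)
  then show ?thesis using pass_label_eqD(3)[of E r f p Q wit x 0 v 0] eq fx by simp
qed

lemma pass_label_bound:
  assumes ok: "pass_ok E n r f p Q wit" and x: "x \<in> scc E r"
    and bound: "\<And>S. finite S \<Longrightarrow> S \<subseteq> scc E r \<Longrightarrow> indep E S \<Longrightarrow> card S \<le> a"
  shows "pass_label E r f p Q wit x + 1 < 12 * a"
proof -
  let ?W = "Q \<inter> layer E r f x"
  have W: "finite ?W" "wit x \<in> ?W" "indep E ?W" "?W \<subseteq> scc E r"
    using ok x by (auto simp: pass_ok_def layer_def)
  have "card {t\<in>?W. t < wit x} < card ?W" using W by (intro psubset_card_mono) auto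
  also have "\<dots> \<le> a" using W bound by blast
  finally show ?thesis using witness_kind_le[of E p "wit x" x] unfolding pass_label_def by simp
qed

text \<open>Odd labels mark exactly the out-neighbours of \<open>r\<close>, so a component of a label class was labelled in one
direction throughout.\<close>

theorem refinement_round:
  assumes free: "C3_free_rel E"
    and fwd: "pass_ok E n r f p Q wit" and bwd: "pass_ok (E\<inverse>) n r f' p' Q' wit'"
    and lab: "\<And>x. x \<in> scc E r \<Longrightarrow> lab x = (if f x = n then pass_label (E\<inverse>) r f' p' Q' wit' x + 1
                                         else pass_label E r f p Q wit x)"
    and bound: "\<And>S. finite S \<Longrightarrow> S \<subseteq> scc E r \<Longrightarrow> indep E S \<Longrightarrow> card S \<le> a"
    and v: "v \<in> scc E r"
    and F: "F = {(x, y) \<in> E. lab x = lab y}"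
    and S: "finite S" "S \<subseteq> scc F v" "indep F S"
  shows "card S \<le> max 1 (a - 1)"
proof -
  have FE: "F \<subseteq> E" using F by auto
  have lab_eq: "lab x = lab v" if "x \<in> scc F v" for x
  proof -
    have "(v, x) \<in> F\<^sup>*" using that by (simp add: scc_def)
    then show ?thesis by (induction rule: rtrancl_induct) (auto simp: F)
  qed
  have sub: "scc F v \<subseteq> scc E r" using scc_mono[OF FE, of v] scc_eq[OF v] by simp
  have SE: "indep E S"
    unfolding indep_def
  proof (intro ballI notI)
    fix u w assume uw: "u \<in> S" "w \<in> S" "(u, w) \<in> E"
    then have "lab u = lab w" using lab_eq[of u] lab_eq[of w] S(2) by (simp add: subset_iff)
    then have "(u, w) \<in> F" using uw(3) by (simp add: F)
    then show False using S(3) uw(1,2) by (simp add: indep_def)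
  qed
  have odd_lab: "odd (lab x) \<longleftrightarrow> f x = n" if "x \<in> scc E r" for x
    using lab[OF that] by (auto simp: pass_label_def)
  have fn: "f x = n \<longleftrightarrow> f v = n" if "x \<in> scc F v" for x
    using odd_lab[of x] odd_lab[OF v] lab_eq[OF that] sub that by auto
  \<comment> \<open>the labels of the two directions agree along arcs of the new component, though not along all
    arcs of \<open>F\<close>; hence the restriction\<close>
  define G where "G = F \<inter> scc F v \<times> scc F v"
  have path: "(u, w) \<in> G\<^sup>*" if "u \<in> scc F v" "(u, w) \<in> F\<^sup>*" "w \<in> scc F v" for u w
    using that(2,1,3)
  proof (induction rule: converse_rtrancl_induct)
    case (step y z)
    have "z \<in> scc F v" using scc_path[OF step.prems r_into_rtrancl[OF step.hyps(1)] step.hyps(2)] .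
    then show ?case using step by (auto simp: G_def intro: converse_rtrancl_into_rtrancl)
  qed simp
  have sccG: "scc G v = scc F v"
  proof
    show "scc G v \<subseteq> scc F v" by (rule scc_mono) (simp add: G_def)
    show "scc F v \<subseteq> scc G v" using path[of v] path[of _ v] by (auto simp: scc_def)
  qed
  have GE: "G \<subseteq> E" using FE by (auto simp: G_def)
  show ?thesis
  proof (cases "f v = n")
    case False
    have eq: "pass_label E r f p Q wit x = pass_label E r f p Q wit y"
      if "x \<in> scc F v" "y \<in> scc F v" for x y
      using lab[of x] lab[of y] False fn[of x] fn[of y] lab_eq[of x] lab_eq[of y]
        that subsetD[OF sub that(1)] subsetD[OF sub that(2)] by simp
    have same: "f x = f v \<and> wit x = wit v \<and> witness_kind E p (wit x) x = witness_kind E p (wit v) v"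
      if "x \<in> scc G v" for x
    proof (rule same_label_pass[OF fwd GE _ v that])
      show "pass_label E r f p Q wit x = pass_label E r f p Q wit v"
        using that by (intro eq) (simp_all add: sccG)
      show "pass_label E r f p Q wit u = pass_label E r f p Q wit w" if "(u, w) \<in> G" for u w
        using that by (intro eq) (simp_all add: G_def)
    qed
    show ?thesis
      by (rule independence_drop[OF free fwd bound GE v same False S(1)])
         (use S(2) SE in \<open>simp_all add: sccG\<close>)
  next
    case True
    have GE': "G\<inverse> \<subseteq> E\<inverse>" using GE by auto
    have v': "v \<in> scc (E\<inverse>) r" using v by simp
    have eq: "pass_label (E\<inverse>) r f' p' Q' wit' x = pass_label (E\<inverse>) r f' p' Q' wit' y"
      if "x \<in> scc F v" "y \<in> scc F v" for x y
      using lab[of x] lab[of y] True fn[of x] fn[of y] lab_eq[of x] lab_eq[of y]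
        that subsetD[OF sub that(1)] subsetD[OF sub that(2)] by simp
    have same: "f' x = f' v \<and> wit' x = wit' v \<and>
        witness_kind (E\<inverse>) p' (wit' x) x = witness_kind (E\<inverse>) p' (wit' v) v"
      if "x \<in> scc (G\<inverse>) v" for x
    proof (rule same_label_pass[OF bwd GE' _ v' that])
      show "pass_label (E\<inverse>) r f' p' Q' wit' x = pass_label (E\<inverse>) r f' p' Q' wit' v"
        using that by (intro eq) (simp_all add: sccG)
      show "pass_label (E\<inverse>) r f' p' Q' wit' u = pass_label (E\<inverse>) r f' p' Q' wit' w"
        if "(u, w) \<in> G\<inverse>" for u w
        using that by (intro eq) (simp_all add: G_def)
    qed
    have lev: "is_level E n r f" "is_level (E\<inverse>) n r f'"
      using fwd bwd by (auto simp: pass_ok_def)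
    have vr: "v \<noteq> r" using True is_levelD(1)[OF lev(1)] by auto
    have parent: "(r, v) \<in> E"
      if lev: "is_level E n r f" and v: "v \<in> scc E r" "f v = n" "v \<noteq> r" for E f
    proof -
      have "0 < f v" using is_levelD(3)[OF lev] v(1) by (auto simp: scc_def)
      then obtain u where u: "(u, v) \<in> E" "f u = Suc n" using is_levelD(5)[OF lev _ v(3)] v(2) by auto
      then have "u = r" using is_levelD(2)[OF lev, of u] by (cases "u = r") auto
      then show ?thesis using u(1) by simp
    qed
    \<comment> \<open>an out-neighbour of \<open>r\<close> is not an in-neighbour of \<open>r\<close>, so it is beyond level \<open>n\<close> in the reversed digraph\<close>
    have "(r, v) \<in> E" using parent[OF lev(1) v True vr] .
    then have "f' v \<noteq> n"
      using parent[OF lev(2) v' _ vr] C3_free_relD(2)[OF free] by blast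
    moreover have "card S' \<le> a" if "finite S'" "S' \<subseteq> scc (E\<inverse>) r" "indep (E\<inverse>) S'" for S'
      using bound that by simp
    ultimately show ?thesis
      by (intro independence_drop[OF C3_free_rel_converse[OF free] bwd _ GE' v' same _ S(1)])
         (use S(2) SE in \<open>simp_all add: sccG\<close>)
  qed
qed

text \<open>The label is the same for all one-vertex components, and so a round does not split a colour class that
is acyclic already.\<close>

lemma trivial_scc_label:
  assumes free: "C3_free_rel E" and fwd: "pass_ok E n r f p Q wit" and "scc E r = {r}"
  shows "f r \<noteq> n" "pass_label E r f p Q wit r = 2 * (Suc n mod 2)"
proof -
  have fr: "f r = Suc n" using fwd by (simp add: pass_ok_def is_level_def)
  then show "f r \<noteq> n" by simp
  have "wit r = r" using fwd assms(3) by (auto simp: pass_ok_def layer_def)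
  moreover have "layer E r f r = {r}" using assms(3) by (auto simp: layer_def)
  ultimately show "pass_label E r f p Q wit r = 2 * (Suc n mod 2)"
    using fr C3_free_relD(1)[OF free] by (auto simp: pass_label_def witness_kind_def card_eq_0_iff)
qed

section \<open>Breadth-first levels and the number of labels\<close>

text \<open>The value is the number of rounds, counting the current one, since \<open>v\<close> was found; it is \<open>k + 1\<close> minus
the distance from \<open>r\<close>.\<close>

fun bfs :: "('a \<times> 'a) set \<Rightarrow> 'a \<Rightarrow> nat \<Rightarrow> 'a \<Rightarrow> nat" where
  "bfs E r 0 v = of_bool (v = r)"
| "bfs E r (Suc k) v =
     (if 0 < bfs E r k v \<or> (\<exists>u. 0 < bfs E r k u \<and> (u, v) \<in> E) then Suc (bfs E r k v) else 0)"

lemma bfs_root: "bfs E r k r = Suc k"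
  by (induction k) auto

lemma bfs_le: "v \<noteq> r \<Longrightarrow> bfs E r k v \<le> k"
  by (induction k) auto

lemma bfs_reachable: "0 < bfs E r k v \<Longrightarrow> (r, v) \<in> E\<^sup>*"
proof (induction k arbitrary: v)
  case 0
  then show ?case by (cases "v = r") auto
next
  case (Suc k)
  then consider "0 < bfs E r k v" | u where "0 < bfs E r k u" "(u, v) \<in> E"
    by (auto split: if_splits)
  then show ?case by cases (auto dest: Suc.IH intro: rtrancl_into_rtrancl)
qed

lemma bfs_arc: "(u, v) \<in> E \<Longrightarrow> bfs E r k u \<le> Suc (bfs E r k v)"
  by (induction k) auto

lemma bfs_parent: "0 < bfs E r k v \<Longrightarrow> v \<noteq> r \<Longrightarrow> \<exists>u. (u, v) \<in> E \<and> bfs E r k u = Suc (bfs E r k v)"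
proof (induction k)
  case (Suc k)
  show ?case
  proof (cases "0 < bfs E r k v")
    case True
    then obtain u where "(u, v) \<in> E" "bfs E r k u = Suc (bfs E r k v)" using Suc by blast
    then show ?thesis using True by (intro exI[of _ u]) simp
  next
    case False
    then obtain u where u: "0 < bfs E r k u" "(u, v) \<in> E" using Suc.prems(1) by (auto split: if_splits)
    then have "bfs E r k u = 1" using bfs_arc[OF u(2), of r k] False by simp
    moreover have "bfs E r (Suc k) v = 1" using False Suc.prems(1) by (auto split: if_splits)
    ultimately show ?thesis using u by (intro exI[of _ u]) simp
  qed
qed simp

text \<open>After \<open>n\<close> rounds no vertex has just been found: parents would provide a vertex on each of the levels
\<open>1, \<dots>, n + 1\<close>, which is too many for \<open>n\<close> vertices. Hence the search is complete.\<close>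

lemma bfs_is_level:
  assumes E: "E \<subseteq> {..<n} \<times> {..<n}" and r: "r < n"
  shows "is_level E n r (bfs E r n)"
proof -
  have reach_lt: "v < n" if "(r, v) \<in> E\<^sup>*" for v
    using that r by (induction rule: rtrancl_induct) (use E in auto)
  have not_1: "bfs E r n v \<noteq> 1" for v
  proof
    assume 1: "bfs E r n v = 1"
    have "\<exists>u. bfs E r n u = Suc i" if "i \<le> n" for i
      using that
    proof (induction i)
      case 0
      show ?case using 1 by auto
    next
      case (Suc i)
      then obtain u where u: "bfs E r n u = Suc i" by auto
      then have "u \<noteq> r" using bfs_root[of E r n] Suc.prems by auto
      then show ?case using bfs_parent[of E r n u] u by auto
    qed
    then have "\<exists>u<n. bfs E r n u = i" if "i \<in> {1..Suc n}" for i
      using that bfs_reachable[of E r n, THEN reach_lt] by (cases i) force+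
    then have "{1..Suc n} \<subseteq> bfs E r n ` {..<n}" by force
    then have "card {1..Suc n} \<le> card {..<n}" by (meson surj_card_le finite_lessThan)
    then show False by simp
  qed
  have closed: "0 < bfs E r n v" if "(r, v) \<in> E\<^sup>*" for v
    using that
  proof (induction rule: rtrancl_induct)
    case base
    show ?case by (simp add: bfs_root)
  next
    case (step u v)
    then show ?case using bfs_arc[OF step.hyps(2), of r n] not_1[of u] by linarith
  qed
  show ?thesis
    unfolding is_level_def
    using bfs_root[of E r n] bfs_le[of _ r E n] bfs_reachable[of E r n] closed bfs_arc[of _ _ E r n]
      bfs_parent[of E r n]
    by blast
qed

definition labelled_from :: "(nat \<times> nat) set \<Rightarrow> nat \<Rightarrow> nat \<Rightarrow> (nat \<Rightarrow> nat) \<Rightarrow> bool" where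
  "labelled_from E n r lab \<longleftrightarrow> (\<exists>f p Q wit f' p' Q' wit'.
     pass_ok E n r f p Q wit \<and> pass_ok (E\<inverse>) n r f' p' Q' wit' \<and>
     (\<forall>x\<in>scc E r. lab x = (if f x = n then pass_label (E\<inverse>) r f' p' Q' wit' x + 1
                            else pass_label E r f p Q wit x)))"

lemma labelled_from_cong:
  "labelled_from E n r lab \<Longrightarrow> (\<And>x. x \<in> scc E r \<Longrightarrow> lab' x = lab x) \<Longrightarrow> labelled_from E n r lab'"
  unfolding labelled_from_def by simp

lemma card_image_eq_of_same_kernel:
  assumes "finite X" "\<And>u v. u \<in> X \<Longrightarrow> v \<in> X \<Longrightarrow> f u = f v \<longleftrightarrow> g u = g v"
  shows "card (f ` X) = card (g ` X)"
proof -
  have "bij_betw (\<lambda>y. g (inv_into X f y)) (f ` X) (g ` X)"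
  proof (rule bij_betwI')
    fix x y assume "x \<in> f ` X" "y \<in> f ` X"
    then show "g (inv_into X f x) = g (inv_into X f y) \<longleftrightarrow> x = y"
      using assms(2) by (metis f_inv_into_f inv_into_into)
  next
    fix x assume "x \<in> f ` X"
    then show "g (inv_into X f x) \<in> g ` X" by (simp add: inv_into_into)
  next
    fix y assume "y \<in> g ` X"
    then obtain x where "x \<in> X" "y = g x" by auto
    then show "\<exists>x\<in>f ` X. y = g (inv_into X f x)"
      using assms(2) by (metis f_inv_into_f image_eqI inv_into_into)
  qed
  then show ?thesis by (rule bij_betw_same_card)
qed

text \<open>The number of labels that a round needs when the components have independence number at most \<open>a\<close>;
components with \<open>a \<le> 1\<close> are single vertices and share one label.\<close>

definition palette :: "nat \<Rightarrow> nat" where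
  "palette a = (if a \<ge> 2 then 12 * a else 1)"

lemma palette_product: "(\<Prod>j<k. palette (a - j)) \<le> 12 ^ (a - 1) * fact a"
proof (induction k arbitrary: a)
  case 0
  show ?case by simp
next
  case (Suc k)
  have "(\<Prod>j<Suc k. palette (a - j)) = palette a * (\<Prod>j<k. palette (a - 1 - j))"
    by (subst prod.lessThan_Suc_shift) simp
  also have "\<dots> \<le> palette a * (12 ^ (a - 1 - 1) * fact (a - 1))"
    using Suc.IH[of "a - 1"] by simp
  also have "\<dots> \<le> 12 ^ (a - 1) * fact a"
  proof (cases "a \<ge> 2")
    case True
    then obtain b where "a = Suc (Suc b)" by (metis add_2_eq_Suc le_Suc_ex)
    then show ?thesis by (simp add: palette_def algebra_simps)
  next
    case False
    then have "a = 0 \<or> a = 1" by auto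
    then show ?thesis by (auto simp: palette_def)
  qed
  finally show ?case .
qed

lemma card_labels:
  assumes free: "C3_free_rel E" and lab: "\<And>v. v < n \<Longrightarrow> \<exists>r<n. v \<in> scc E r \<and> labelled_from E n r lab"
    and bound: "\<And>v S. v < n \<Longrightarrow> finite S \<Longrightarrow> S \<subseteq> scc E v \<Longrightarrow> indep E S \<Longrightarrow> card S \<le> max 1 a"
  shows "card (lab ` {..<n}) \<le> palette a"
proof (cases "a \<ge> 2")
  case True
  have "lab v < 12 * a" if v: "v < n" for v
  proof -
    obtain r where r: "r < n" "v \<in> scc E r" "labelled_from E n r lab" using lab[OF v] by blast
    have b: "card S \<le> a" if "finite S" "S \<subseteq> scc E r" "indep E S" for S
      using bound[OF r(1) that] True by simp
    have b': "card S \<le> a" if "finite S" "S \<subseteq> scc (E\<inverse>) r" "indep (E\<inverse>) S" for S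
      using b that by simp
    obtain f p Q wit f' p' Q' wit' where
      ok: "pass_ok E n r f p Q wit" "pass_ok (E\<inverse>) n r f' p' Q' wit'" and
      l: "\<forall>x\<in>scc E r. lab x = (if f x = n then pass_label (E\<inverse>) r f' p' Q' wit' x + 1
                            else pass_label E r f p Q wit x)"
      using r(3) unfolding labelled_from_def by blast
    show ?thesis
      using pass_label_bound[OF ok(1) r(2) b] pass_label_bound[OF ok(2) _ b'] r(2) l by auto
  qed
  then have "lab ` {..<n} \<subseteq> {..<12 * a}" by auto
  then show ?thesis using True card_mono[of "{..<12 * a}" "lab ` {..<n}"] by (simp add: palette_def)
next
  case False
  have "lab v = 2 * (Suc n mod 2)" if v: "v < n" for v
  proof -
    obtain r where r: "r < n" "v \<in> scc E r" "labelled_from E n r lab" using lab[OF v] by blast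
    \<comment> \<open>the constant is the label of a root, which has level \<open>n + 1\<close>\<close>
    have triv: "scc E r = {r}"
      by (rule scc_trivial[OF free]) (use bound[OF r(1)] False in force)
    then have "v = r" using r(2) by simp
    then show ?thesis using r(3) trivial_scc_label[OF free _ triv] triv
      unfolding labelled_from_def by fastforce
  qed
  then have "lab ` {..<n} \<subseteq> {2 * (Suc n mod 2)}" by auto
  then show ?thesis using False card_mono[of "{2 * (Suc n mod 2)}" "lab ` {..<n}"]
    by (simp add: palette_def)
qed

lemma acyclic_of_trivial_sccs:
  assumes free: "C3_free_rel E" and triv: "\<And>v. v \<in> Domain E \<Longrightarrow> scc E v = {v}"
  shows "acyclic E"
proof (rule acyclicI, intro allI notI)
  fix x assume "(x, x) \<in> E\<^sup>+"
  then obtain y where y: "(x, y) \<in> E" "(y, x) \<in> E\<^sup>*" by (meson tranclD)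
  then have "y \<in> scc E x" by (simp add: scc_def r_into_rtrancl)
  then have "y = x" using triv[of x] y(1) by blast
  then show False using y(1) C3_free_relD(1)[OF free] by blast
qed

section \<open>A bounded-loop language and its compiler\<close>

text \<open>Expressions have conditionals and sums of \<open>n\<close> terms; a sum also serves as a bounded existential
quantifier and as a counter. Programs have only loops with \<open>n\<close> iterations, where \<open>n\<close> is the input
scalar. The meaning of a program is then a total function on states, and the running time is a
polynomial in \<open>n\<close> that can be read off from the syntax.\<close>

datatype hexp =
    Lit nat
  | Rd vname hexp
  | Add hexp hexp
  | Sub hexp hexp
  | Ite hexp hexp hexp
  | Sum vname hexp

datatype prog =
    Put vname hexp hexp
  | Then prog prog  (infixr \<open>;;\<close> 60)
  | Loop vname prog

definition set_var :: "state \<Rightarrow> vname \<Rightarrow> nat \<Rightarrow> state" where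
  "set_var s x k = s(x := (s x)(0 := k))"

lemma set_var_apply [simp]: "set_var s x k y = (if y = x then (s x)(0 := k) else s y)"
  by (simp add: set_var_def)

text \<open>The bound variable of a sum is an ordinary scalar of the state, but evaluation has no side effect. The
compiled code uses that scalar and restores it.\<close>

fun heval :: "hexp \<Rightarrow> state \<Rightarrow> nat" where
  "heval (Lit m) s = m"
| "heval (Rd x e) s = s x (heval e s)"
| "heval (Add a b) s = heval a s + heval b s"
| "heval (Sub a b) s = heval a s - heval b s"
| "heval (Ite c a b) s = (if 0 < heval c s then heval a s else heval b s)"
| "heval (Sum x e) s = (\<Sum>k<s ''n'' 0. heval e (set_var s x k))"

fun run :: "prog \<Rightarrow> state \<Rightarrow> state" where
  "run (Put x i e) s = s(x := (s x)(heval i s := heval e s))"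
| "run (p ;; q) s = run q (run p s)"
| "run (Loop x p) s = fold (\<lambda>k s. run p (set_var s x k)) [0..<s ''n'' 0] s"

fun names :: "hexp \<Rightarrow> vname set" where
  "names (Lit m) = {}"
| "names (Rd x e) = insert x (names e)"
| "names (Add a b) = names a \<union> names b"
| "names (Sub a b) = names a \<union> names b"
| "names (Ite c a b) = names c \<union> names a \<union> names b"
| "names (Sum x e) = insert x (names e)"

fun binders :: "hexp \<Rightarrow> vname set" where
  "binders (Lit m) = {}"
| "binders (Rd x e) = binders e"
| "binders (Add a b) = binders a \<union> binders b"
| "binders (Sub a b) = binders a \<union> binders b"
| "binders (Ite c a b) = binders c \<union> binders a \<union> binders b"
| "binders (Sum x e) = insert x (binders e)"

fun writes :: "prog \<Rightarrow> vname set" where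
  "writes (Put x i e) = {x}"
| "writes (p ;; q) = writes p \<union> writes q"
| "writes (Loop x p) = insert x (writes p)"

text \<open>The array \<open>t\<close> is the evaluation stack of compiled code, and \<open>n\<close> must keep its value because it bounds
all loops.\<close>

fun compilable :: "prog \<Rightarrow> bool" where
  "compilable (Put x i e) \<longleftrightarrow> x \<noteq> ''t'' \<and> x \<noteq> ''n'' \<and> ''t'' \<notin> names i \<union> names e \<and>
     ''n'' \<notin> binders i \<union> binders e"
| "compilable (p ;; q) \<longleftrightarrow> compilable p \<and> compilable q"
| "compilable (Loop x p) \<longleftrightarrow> x \<noteq> ''t'' \<and> x \<noteq> ''n'' \<and> compilable p"

abbreviation temp :: "nat \<Rightarrow> expr" where "temp k \<equiv> Cell ''t'' (Const k)"
abbreviation scalar :: "vname \<Rightarrow> expr" where "scalar x \<equiv> Cell x (Const 0)"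
abbreviation set_temp :: "nat \<Rightarrow> expr \<Rightarrow> com" where "set_temp k \<equiv> Assign ''t'' (Const k)"

text \<open>The result is left in cell \<open>k\<close> of the stack; cells below \<open>k\<close> are preserved. A sum uses three cells: the
accumulator, the counter and the saved value of the bound variable.\<close>

fun compile_exp :: "nat \<Rightarrow> hexp \<Rightarrow> com" where
  "compile_exp k (Lit m) = set_temp k (Const m)"
| "compile_exp k (Rd x e) = Seq (compile_exp k e) (set_temp k (Cell x (temp k)))"
| "compile_exp k (Add a b) =
     Seq (compile_exp k a) (Seq (compile_exp (Suc k) b) (set_temp k (Plus (temp k) (temp (Suc k)))))"
| "compile_exp k (Sub a b) =
     Seq (compile_exp k a) (Seq (compile_exp (Suc k) b) (set_temp k (Minus (temp k) (temp (Suc k)))))"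
| "compile_exp k (Ite c a b) =
     Seq (compile_exp k c) (If (temp k) (compile_exp k a) (compile_exp k b))"
| "compile_exp k (Sum x e) =
     Seq (set_temp k (Const 0)) (Seq (set_temp (k+1) (Const 0)) (Seq (set_temp (k+2) (scalar x)) (Seq
       (While (Minus (scalar ''n'') (temp (k+1)))
         (Seq (Assign x (Const 0) (temp (k+1))) (Seq (compile_exp (k+3) e)
           (Seq (set_temp k (Plus (temp k) (temp (k+3)))) (set_temp (k+1) (Plus (temp (k+1)) (Const 1)))))))
       (Assign x (Const 0) (temp (k+2))))))"

text \<open>The loop counter lives on the stack and is copied into the loop variable before each iteration, so the
body may assign to that variable.\<close>

fun compile :: "nat \<Rightarrow> prog \<Rightarrow> com" where
  "compile k (Put x i e) =
     Seq (compile_exp k i) (Seq (compile_exp (Suc k) e) (Assign x (temp k) (temp (Suc k))))"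
| "compile k (p ;; q) = Seq (compile k p) (compile k q)"
| "compile k (Loop x p) =
     Seq (set_temp k (Const 0))
       (While (Minus (scalar ''n'') (temp k))
         (Seq (Assign x (Const 0) (temp k)) (Seq (compile (Suc k) p)
           (set_temp k (Plus (temp k) (Const 1))))))"

text \<open>Upper bounds only; the constants cover the cost of the instructions emitted by the compiler.\<close>

fun exp_time :: "hexp \<Rightarrow> nat \<Rightarrow> nat" where
  "exp_time (Lit m) n = 3"
| "exp_time (Rd x e) n = exp_time e n + 5"
| "exp_time (Add a b) n = exp_time a n + exp_time b n + 7"
| "exp_time (Sub a b) n = exp_time a n + exp_time b n + 7"
| "exp_time (Ite c a b) n = exp_time c n + exp_time a n + exp_time b n + 3"
| "exp_time (Sum x e) n = 20 + n * (exp_time e n + 30)"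

fun prog_time :: "prog \<Rightarrow> nat \<Rightarrow> nat" where
  "prog_time (Put x i e) n = exp_time i n + exp_time e n + 5"
| "prog_time (p ;; q) n = prog_time p n + prog_time q n"
| "prog_time (Loop x p) n = 20 + n * (prog_time p n + 30)"

lemma heval_cong: "(\<And>x. x \<in> insert ''n'' (names e) \<Longrightarrow> s x = s' x) \<Longrightarrow> heval e s = heval e s'"
proof (induction e arbitrary: s s')
  case (Sum x e)
  have "s ''n'' 0 = s' ''n'' 0" using Sum.prems by simp
  moreover have "heval e (set_var s x k) = heval e (set_var s' x k)" for k
  proof (rule Sum.IH)
    fix y assume "y \<in> insert ''n'' (names e)"
    then show "set_var s x k y = set_var s' x k y"
      using Sum.prems[of y] Sum.prems[of x] by (cases "y = x") simp_all
  qed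
  ultimately show ?case by simp
next
  case (Rd x e)
  have "heval e s = heval e s'" by (rule Rd.IH, rule Rd.prems) auto
  then show ?case using Rd.prems by simp
next
  case (Add a b)
  have "heval a s = heval a s'" "heval b s = heval b s'"
    using Add.prems by (auto intro!: Add.IH)
  then show ?case by simp
next
  case (Sub a b)
  have "heval a s = heval a s'" "heval b s = heval b s'"
    using Sub.prems by (auto intro!: Sub.IH)
  then show ?case by simp
next
  case (Ite c a b)
  have "heval a s = heval a s'" "heval b s = heval b s'" "heval c s = heval c s'"
    using Ite.prems by (auto intro!: Ite.IH)
  then show ?case by simp
qed simp

lemma run_frame: "y \<notin> writes p \<Longrightarrow> run p s y = s y"
proof (induction p arbitrary: s)
  case (Loop x p)
  have "fold (\<lambda>k s. run p (set_var s x k)) ks s y = s y" for ks s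
    using Loop by (induction ks arbitrary: s) auto
  then show ?case by simp
qed auto

text \<open>The invariant speaks of the state before the loop variable is set.\<close>

lemma run_Loop_inv:
  assumes "I 0 s"
    and "\<And>k s. k < n \<Longrightarrow> I k s \<Longrightarrow> I (Suc k) (run p (set_var s x k))"
    and "s ''n'' 0 = n"
  shows "I n (run (Loop x p) s)"
proof -
  have "I m (fold (\<lambda>k s. run p (set_var s x k)) [0..<m] s)" if "m \<le> n" for m
    using that assms by (induction m) auto
  then show ?thesis using assms(3) by simp
qed

definition terminates :: "com \<Rightarrow> state \<Rightarrow> nat \<Rightarrow> (state \<Rightarrow> bool) \<Rightarrow> bool" where
  "terminates c s t Q \<longleftrightarrow> (\<exists>t' s'. exec c s t' s' \<and> t' \<le> t \<and> Q s')"

lemma terminates_weaken: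
  "terminates c s t Q \<Longrightarrow> t \<le> t' \<Longrightarrow> (\<And>s'. Q s' \<Longrightarrow> Q' s') \<Longrightarrow> terminates c s t' Q'"
  unfolding terminates_def by (meson le_trans)

lemma terminates_Seq:
  "terminates c s t1 R \<Longrightarrow> (\<And>s'. R s' \<Longrightarrow> terminates d s' t2 Q) \<Longrightarrow> terminates (Seq c d) s (t1 + t2) Q"
  unfolding terminates_def by (metis exec.Seq add_mono)

lemma terminates_Assign:
  "Q (s(x := (s x)(eval_expr i s := eval_expr e s))) \<Longrightarrow> expr_cost i = a \<Longrightarrow> expr_cost e = b \<Longrightarrow>
     terminates (Assign x i e) s (a + b + 1) Q"
  unfolding terminates_def by (metis exec.Assign order_refl)

lemma terminates_Assign_Seq:
  assumes "s1 = s(x := (s x)(eval_expr i s := eval_expr e s))" "terminates d s1 t Q"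
    and "expr_cost i = a" "expr_cost e = b"
  shows "terminates (Seq (Assign x i e) d) s ((a + b + 1) + t) Q"
  using terminates_Seq[OF terminates_Assign[where Q = "\<lambda>s'. s' = s1"], where ?t2.0 = t and Q = Q] assms
  by blast

lemma terminates_If:
  assumes "eval_expr b s \<noteq> 0 \<Longrightarrow> terminates c s t1 Q" "eval_expr b s = 0 \<Longrightarrow> terminates d s t2 Q"
  shows "terminates (If b c d) s (expr_cost b + (t1 + t2) + 1) Q"
proof (cases "eval_expr b s = 0")
  case True
  with assms(2) obtain t' s' where *: "exec d s t' s'" "t' \<le> t2" "Q s'"
    unfolding terminates_def by auto
  then show ?thesis unfolding terminates_def
    using exec.IfFalse[OF True *(1), of c] *(2,3) by (intro exI conjI) auto
next
  case False
  with assms(1) obtain t' s' where *: "exec c s t' s'" "t' \<le> t1" "Q s'"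
    unfolding terminates_def by auto
  then show ?thesis unfolding terminates_def
    using exec.IfTrue[OF False *(1), of d] *(2,3) by (intro exI conjI) auto
qed

text \<open>The only form of loop that the compiler emits: the guard is the number of remaining iterations.\<close>

lemma terminates_count_up:
  assumes "\<And>i s. i < n \<Longrightarrow> I i s \<Longrightarrow> terminates c s t (I (Suc i))"
    and guard: "\<And>i s. I i s \<Longrightarrow> i \<le> n \<Longrightarrow> eval_expr b s = n - i"
    and "I 0 s"
  shows "terminates (While b c) s (n * (expr_cost b + t + 1) + (expr_cost b + 1)) (I n)"
proof -
  have "terminates (While b c) s (k * (expr_cost b + t + 1) + (expr_cost b + 1)) (I n)"
    if "k \<le> n" "I (n - k) s" for k s
    using that
  proof (induction k arbitrary: s)
    case 0
    then have "eval_expr b s = 0" using guard[of n s] by simp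
    then show ?case unfolding terminates_def using 0 exec.WhileFalse[of b s c] by auto
  next
    case (Suc k)
    then have lt: "n - Suc k < n" and eq: "Suc (n - Suc k) = n - k" by simp_all
    obtain t1 s1 where 1: "exec c s t1 s1" "t1 \<le> t" "I (n - k) s1"
      using assms(1)[OF lt Suc.prems(2)] unfolding eq terminates_def by auto
    obtain t2 s2 where 2: "exec (While b c) s1 t2 s2"
      "t2 \<le> k * (expr_cost b + t + 1) + (expr_cost b + 1)" "I n s2"
      using Suc.IH[OF _ 1(3)] Suc.prems(1) unfolding terminates_def by auto
    have "eval_expr b s \<noteq> 0" using guard[OF Suc.prems(2)] Suc.prems(1) by simp
    from exec.WhileTrue[OF this 1(1) 2(1)] show ?case
      unfolding terminates_def using 1(2) 2(2,3) by (intro exI conjI) auto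
  qed
  from this[of n s] show ?thesis using assms(3) by simp
qed

text \<open>The machine state \<open>s\<close> and the state \<open>s0\<close> of the source program agree only outside the stack. Stating the
result with two states avoids any appeal to the insensitivity of evaluation to the stack.\<close>

lemma compile_exp_correct:
  assumes "''t'' \<notin> names e" "''n'' \<notin> binders e" "s0 ''n'' 0 = n" "\<forall>x. x \<noteq> ''t'' \<longrightarrow> s x = s0 x"
  shows "terminates (compile_exp k e) s (exp_time e n)
    (\<lambda>s'. s' ''t'' k = heval e s0 \<and> (\<forall>j<k. s' ''t'' j = s ''t'' j) \<and> (\<forall>x. x \<noteq> ''t'' \<longrightarrow> s' x = s0 x))"
    (is "terminates _ _ _ (?post e k s0 s)")
  using assms
proof (induction e arbitrary: k s s0)
  case (Lit m)
  have "terminates (compile_exp k (Lit m)) s (1 + 1 + 1) (?post (Lit m) k s0 s)"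
    unfolding compile_exp.simps
    by (rule terminates_Assign) (use Lit in auto)
  then show ?case by (simp add: numeral_3_eq_3)
next
  case (Rd x e)
  have "terminates (compile_exp k (Rd x e)) s (exp_time e n + (1 + 3 + 1)) (?post (Rd x e) k s0 s)"
    unfolding compile_exp.simps
    by (rule terminates_Seq[OF Rd.IH[of s0 s k]], (use Rd.prems in simp_all)[4],
        rule terminates_Assign, use Rd.prems in auto)
  then show ?case by (rule terminates_weaken) simp_all
next
  case (Add a b)
  have "terminates (compile_exp k (Add a b)) s (exp_time a n + (exp_time b n + (1 + 5 + 1)))
     (?post (Add a b) k s0 s)"
    unfolding compile_exp.simps
    by (rule terminates_Seq[OF Add.IH(1)[of s0]], (use Add.prems in simp_all)[4],
        rule terminates_Seq[OF Add.IH(2)[of s0]], (use Add.prems in simp_all)[4],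
        rule terminates_Assign, auto)
  then show ?case by (rule terminates_weaken) simp_all
next
  case (Sub a b)
  have "terminates (compile_exp k (Sub a b)) s (exp_time a n + (exp_time b n + (1 + 5 + 1)))
     (?post (Sub a b) k s0 s)"
    unfolding compile_exp.simps
    by (rule terminates_Seq[OF Sub.IH(1)[of s0]], (use Sub.prems in simp_all)[4],
        rule terminates_Seq[OF Sub.IH(2)[of s0]], (use Sub.prems in simp_all)[4],
        rule terminates_Assign, auto)
  then show ?case by (rule terminates_weaken) simp_all
next
  case (Ite c a b)
  have "terminates (compile_exp k (Ite c a b)) s
     (exp_time c n + (2 + (exp_time a n + exp_time b n) + 1)) (?post (Ite c a b) k s0 s)"
    unfolding compile_exp.simps
  proof (rule terminates_Seq[OF Ite.IH(1)[of s0]])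
    fix s' assume s': "?post c k s0 s s'"
    have "terminates (If (temp k) (compile_exp k a) (compile_exp k b)) s'
        (expr_cost (temp k) + (exp_time a n + exp_time b n) + 1) (?post (Ite c a b) k s0 s)"
    proof (rule terminates_If)
      assume "eval_expr (temp k) s' \<noteq> 0"
      then show "terminates (compile_exp k a) s' (exp_time a n) (?post (Ite c a b) k s0 s)"
        by (intro terminates_weaken[OF Ite.IH(2)[of s0]]) (use s' Ite.prems in auto)
    next
      assume "eval_expr (temp k) s' = 0"
      then show "terminates (compile_exp k b) s' (exp_time b n) (?post (Ite c a b) k s0 s)"
        by (intro terminates_weaken[OF Ite.IH(3)[of s0]]) (use s' Ite.prems in auto)
    qed
    then show "terminates (If (temp k) (compile_exp k a) (compile_exp k b)) s'
        (2 + (exp_time a n + exp_time b n) + 1) (?post (Ite c a b) k s0 s)"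
      by simp
  qed (use Ite.prems in simp_all)
  then show ?case by (rule terminates_weaken) simp_all
next
  case (Sum x e)
  have x: "x \<noteq> ''t''" "x \<noteq> ''n''" using Sum.prems by auto
  define I where "I i s' \<longleftrightarrow> s' ''t'' k = (\<Sum>j<i. heval e (set_var s0 x j)) \<and> s' ''t'' (k+1) = i \<and>
    s' ''t'' (k+2) = s0 x 0 \<and> (\<forall>j<k. s' ''t'' j = s ''t'' j) \<and>
    (\<forall>j>0. s' x j = s0 x j) \<and> (\<forall>y. y \<noteq> ''t'' \<and> y \<noteq> x \<longrightarrow> s' y = s0 y)" for i and s' :: state
  let ?body = "Seq (Assign x (Const 0) (temp (k+1))) (Seq (compile_exp (k+3) e)
           (Seq (set_temp k (Plus (temp k) (temp (k+3)))) (set_temp (k+1) (Plus (temp (k+1)) (Const 1)))))"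
  have body: "terminates ?body s' ((1 + 2 + 1) + (exp_time e n + ((1 + 5 + 1) + (1 + 4 + 1)))) (I (Suc i))"
    if "i < n" and I: "I i s'" for i s'
  proof -
    define s1 where "s1 = set_var s' x i"
    have s1: "\<forall>y. y \<noteq> ''t'' \<longrightarrow> s1 y = set_var s0 x i y" "s1 ''t'' = s' ''t''"
      using I x by (auto simp: s1_def I_def fun_eq_iff)
    have step: "I (Suc i) (s2(''t'' := (s2 ''t'')(k := s2 ''t'' k + s2 ''t'' (k+3), k+1 := s2 ''t'' (k+1) + 1)))"
      if s2: "?post e (k+3) (set_var s0 x i) s1 s2" for s2
    proof -
      have "s2 ''t'' j = s' ''t'' j" if "j < k + 3" for j using s2 s1(2) that by simp
      moreover have "s2 ''t'' (k+3) = heval e (set_var s0 x i)" using s2 by (simp only:)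
      ultimately show ?thesis using s2 I x by (simp add: I_def)
    qed
    show ?thesis
    proof (rule terminates_Seq)
      show "terminates (Assign x (Const 0) (temp (k+1))) s' (1 + 2 + 1) (\<lambda>s'. s' = s1)"
        by (rule terminates_Assign) (use I in \<open>simp_all add: s1_def I_def set_var_def\<close>)
      fix s1' assume "s1' = s1"
      then show "terminates (Seq (compile_exp (k+3) e)
           (Seq (set_temp k (Plus (temp k) (temp (k+3)))) (set_temp (k+1) (Plus (temp (k+1)) (Const 1))))) s1'
           (exp_time e n + ((1 + 5 + 1) + (1 + 4 + 1))) (I (Suc i))"
      proof (simp only:, intro terminates_Seq[OF Sum.IH[where ?s0.0 = "set_var s0 x i"]])
        fix s2 assume s2: "?post e (k+3) (set_var s0 x i) s1 s2"
        show "terminates (Seq (set_temp k (Plus (temp k) (temp (k+3)))) (set_temp (k+1) (Plus (temp (k+1)) (Const 1)))) s2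
            ((1 + 5 + 1) + (1 + 4 + 1)) (I (Suc i))"
        proof (rule terminates_Seq)
          show "terminates (set_temp k (Plus (temp k) (temp (k+3)))) s2 (1 + 5 + 1)
            (\<lambda>s'. s' = s2(''t'' := (s2 ''t'')(k := s2 ''t'' k + s2 ''t'' (k+3))))"
            by (rule terminates_Assign) simp_all
          show "terminates (set_temp (k+1) (Plus (temp (k+1)) (Const 1))) s3 (1 + 4 + 1) (I (Suc i))"
            if "s3 = s2(''t'' := (s2 ''t'')(k := s2 ''t'' k + s2 ''t'' (k+3)))" for s3
            by (rule terminates_Assign) (use step[OF s2] that in simp_all)
        qed
      qed (use Sum.prems s1 x in simp_all)
    qed
  qed
  have loop: "terminates (While (Minus (scalar ''n'') (temp (k+1))) ?body) s'
      (n * (5 + ((1 + 2 + 1) + (exp_time e n + ((1 + 5 + 1) + (1 + 4 + 1)))) + 1) + (5 + 1)) (I n)"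
    if "I 0 s'" for s'
  proof -
    have guard: "eval_expr (Minus (scalar ''n'') (temp (k+1))) s' = n - i" if "I i s'" for i s'
      using that x Sum.prems by (simp add: I_def)
    have "expr_cost (Minus (scalar ''n'') (temp (k+1))) = 5" by simp
    then show ?thesis
      using terminates_count_up[where I = I, OF body guard that] by (simp only:)
  qed
  define s1 where "s1 = s(''t'' := (s ''t'')(k := 0, k+1 := 0, k+2 := s0 x 0))"
  have init: "I 0 s1" using x Sum.prems by (simp add: I_def s1_def)
  have 1: "terminates (Seq (While (Minus (scalar ''n'') (temp (k+1))) ?body) (Assign x (Const 0) (temp (k+2)))) s1
      ((n * (5 + ((1 + 2 + 1) + (exp_time e n + ((1 + 5 + 1) + (1 + 4 + 1)))) + 1) + (5 + 1)) +
        (1 + 2 + 1)) (?post (Sum x e) k s0 s)"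
    by (rule terminates_Seq[OF loop[OF init]], rule terminates_Assign)
       (use x Sum.prems(3) in \<open>auto simp: I_def fun_eq_iff\<close>)
  have "terminates (compile_exp k (Sum x e)) s
     ((1 + 1 + 1) + ((1 + 1 + 1) + ((1 + 2 + 1) +
       ((n * (5 + ((1 + 2 + 1) + (exp_time e n + ((1 + 5 + 1) + (1 + 4 + 1)))) + 1) + (5 + 1)) +
        (1 + 2 + 1))))) (?post (Sum x e) k s0 s)"
    unfolding compile_exp.simps
    by (rule terminates_Assign_Seq[where ?s1.0 = "s(''t'' := (s ''t'')(k := 0))"], simp,
        rule terminates_Assign_Seq[where ?s1.0 = "s(''t'' := (s ''t'')(k := 0, k+1 := 0))"], simp,
        rule terminates_Assign_Seq[OF _ 1])
       (use x Sum.prems in \<open>simp_all add: s1_def\<close>)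
  then show ?case by (rule terminates_weaken) (simp_all add: algebra_simps)
qed

lemma writes_n: "compilable p \<Longrightarrow> ''n'' \<notin> writes p"
  by (induction p) auto

lemma compile_correct:
  assumes "compilable p" "s0 ''n'' 0 = n" "\<forall>x. x \<noteq> ''t'' \<longrightarrow> s x = s0 x"
  shows "terminates (compile k p) s (prog_time p n)
    (\<lambda>s'. (\<forall>j<k. s' ''t'' j = s ''t'' j) \<and> (\<forall>x. x \<noteq> ''t'' \<longrightarrow> s' x = run p s0 x))"
    (is "terminates _ _ _ (?post p k s0 s)")
  using assms
proof (induction p arbitrary: k s s0)
  case (Put x i e)
  have "terminates (compile k (Put x i e)) s (exp_time i n + (exp_time e n + (2 + 2 + 1)))
    (?post (Put x i e) k s0 s)"
    unfolding compile.simps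
    by (rule terminates_Seq[OF compile_exp_correct[of _ s0]], (use Put.prems in simp_all)[4],
        rule terminates_Seq[OF compile_exp_correct[of _ s0]], (use Put.prems in simp_all)[4],
        rule terminates_Assign, use Put.prems in auto)
  then show ?case by (rule terminates_weaken) simp_all
next
  case (Then p q)
  have n: "run p s0 ''n'' = s0 ''n''" using Then.prems by (simp add: run_frame writes_n)
  show ?case
    unfolding compile.simps prog_time.simps
    by (rule terminates_Seq[OF Then.IH(1)[of s0]], (use Then.prems in simp_all)[3],
        rule terminates_weaken[OF Then.IH(2)[of "run p s0"]], use Then.prems n in auto)
next
  case (Loop x p)
  have x: "x \<noteq> ''t''" "x \<noteq> ''n''" using Loop.prems by auto
  define R where "R i = fold (\<lambda>k s. run p (set_var s x k)) [0..<i] s0" for i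
  have R0: "R 0 = s0" and RS: "R (Suc i) = run p (set_var (R i) x i)" for i by (auto simp: R_def)
  have Rn: "R i ''n'' = s0 ''n''" for i
    using Loop.prems by (induction i) (auto simp: R0 RS run_frame writes_n)
  define I where "I i s' \<longleftrightarrow> s' ''t'' k = i \<and> (\<forall>j<k. s' ''t'' j = s ''t'' j) \<and>
    (\<forall>y. y \<noteq> ''t'' \<longrightarrow> s' y = R i y)" for i and s' :: state
  let ?body = "Seq (Assign x (Const 0) (temp k)) (Seq (compile (Suc k) p) (set_temp k (Plus (temp k) (Const 1))))"
  have body: "terminates ?body s' ((1 + 2 + 1) + (prog_time p n + (1 + 4 + 1))) (I (Suc i))"
    if "i < n" and I: "I i s'" for i s'
  proof -
    define s1 where "s1 = set_var s' x i"
    have s1: "\<forall>y. y \<noteq> ''t'' \<longrightarrow> s1 y = set_var (R i) x i y" "s1 ''t'' = s' ''t''"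
      using I x by (auto simp: s1_def I_def)
    have step: "I (Suc i) (s2(''t'' := (s2 ''t'')(k := s2 ''t'' k + 1)))"
      if s2: "?post p (Suc k) (set_var (R i) x i) s1 s2" for s2
    proof -
      have "\<forall>y. y \<noteq> ''t'' \<longrightarrow> s2 y = run p (set_var (R i) x i) y" using s2 by (rule conjunct2)
      then show ?thesis using s2 I x by (simp add: I_def RS s1(2))
    qed
    show ?thesis
    proof (rule terminates_Seq)
      show "terminates (Assign x (Const 0) (temp k)) s' (1 + 2 + 1) (\<lambda>s'. s' = s1)"
        by (rule terminates_Assign) (use I in \<open>simp_all add: s1_def I_def set_var_def\<close>)
      fix s1' assume "s1' = s1"
      then show "terminates (Seq (compile (Suc k) p) (set_temp k (Plus (temp k) (Const 1)))) s1'
           (prog_time p n + (1 + 4 + 1)) (I (Suc i))"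
      proof (simp only:, intro terminates_Seq[OF Loop.IH[of "set_var (R i) x i"]])
        fix s2 assume s2: "?post p (Suc k) (set_var (R i) x i) s1 s2"
        show "terminates (set_temp k (Plus (temp k) (Const 1))) s2 (1 + 4 + 1) (I (Suc i))"
          by (rule terminates_Assign) (use step[OF s2] in simp_all)
      qed (use Loop.prems s1 x Rn in simp_all)
    qed
  qed
  have loop: "terminates (While (Minus (scalar ''n'') (temp k)) ?body) s'
      (n * (5 + ((1 + 2 + 1) + (prog_time p n + (1 + 4 + 1))) + 1) + (5 + 1)) (I n)" if "I 0 s'" for s'
  proof -
    have guard: "eval_expr (Minus (scalar ''n'') (temp k)) s' = n - i" if "I i s'" for i s'
      using that x Loop.prems by (simp add: I_def Rn)
    have "expr_cost (Minus (scalar ''n'') (temp k)) = 5" by simp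
    then show ?thesis
      using terminates_count_up[where I = I, OF body guard that] by (simp only:)
  qed
  have "terminates (compile k (Loop x p)) s
      ((1 + 1 + 1) + (n * (5 + ((1 + 2 + 1) + (prog_time p n + (1 + 4 + 1))) + 1) + (5 + 1)))
      (?post (Loop x p) k s0 s)"
    unfolding compile.simps
  proof (rule terminates_Assign_Seq)
    have "I 0 (s(''t'' := (s ''t'')(k := 0)))" using Loop.prems by (simp add: I_def R0)
    from terminates_weaken[OF loop[OF this] order_refl]
    show "terminates (While (Minus (scalar ''n'') (temp k)) ?body) (s(''t'' := (s ''t'')(k := 0)))
        (n * (5 + ((1 + 2 + 1) + (prog_time p n + (1 + 4 + 1))) + 1) + (5 + 1)) (?post (Loop x p) k s0 s)"
      using Loop.prems(2) by (auto simp: I_def R_def)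
  qed simp_all
  then show ?case by (rule terminates_weaken) (simp_all add: algebra_simps)
qed

lemma exp_time_poly: "\<exists>p :: nat poly. \<forall>n. exp_time e n = poly p n"
proof (induction e)
  case (Sum x e)
  then obtain p where "\<forall>n. exp_time e n = poly p n" by blast
  then show ?case by (intro exI[of _ "[:20:] + [:0, 1:] * (p + [:30:])"]) simp
next
  case (Lit m) show ?case by (intro exI[of _ "[:3:]"]) simp
next
  case (Rd x e)
  then obtain p where "\<forall>n. exp_time e n = poly p n" by blast
  then show ?case by (intro exI[of _ "p + [:5:]"]) simp
next
  case (Add a b)
  then obtain p q where "\<forall>n. exp_time a n = poly p n" "\<forall>n. exp_time b n = poly q n" by blast
  then show ?case by (intro exI[of _ "p + q + [:7:]"]) simp
next
  case (Sub a b)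
  then obtain p q where "\<forall>n. exp_time a n = poly p n" "\<forall>n. exp_time b n = poly q n" by blast
  then show ?case by (intro exI[of _ "p + q + [:7:]"]) simp
next
  case (Ite c a b)
  then obtain p q r where "\<forall>n. exp_time a n = poly p n" "\<forall>n. exp_time b n = poly q n"
    "\<forall>n. exp_time c n = poly r n" by blast
  then show ?case by (intro exI[of _ "r + p + q + [:3:]"]) simp
qed

lemma prog_time_poly: "\<exists>p :: nat poly. \<forall>n. prog_time q n = poly p n"
proof (induction q)
  case (Put x i e)
  obtain p q where "\<forall>n. exp_time i n = poly p n" "\<forall>n. exp_time e n = poly q n"
    using exp_time_poly by metis
  then show ?case by (intro exI[of _ "p + q + [:5:]"]) simp
next
  case (Then p q)
  then obtain a b where "\<forall>n. prog_time p n = poly a n" "\<forall>n. prog_time q n = poly b n" by blast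
  then show ?case by (intro exI[of _ "a + b"]) simp
next
  case (Loop x q)
  then obtain p where "\<forall>n. prog_time q n = poly p n" by blast
  then show ?case by (intro exI[of _ "[:20:] + [:0, 1:] * (p + [:30:])"]) simp
qed

section \<open>The refinement program\<close>

abbreviation Var :: "vname \<Rightarrow> hexp" where "Var x \<equiv> Rd x (Lit 0)"

text \<open>Truth values are numbers, and every nonzero number counts as true.\<close>

definition "NotE e = Ite e (Lit 0) (Lit 1)"
definition "AndE a b = Ite a (Ite b (Lit 1) (Lit 0)) (Lit 0)"
definition "OrE a b = Ite a (Lit 1) (Ite b (Lit 1) (Lit 0))"
definition "EqE a b = NotE (Add (Sub a b) (Sub b a))"
definition "LessE a b = Sub b a"
definition "ExE x e = Ite (Sum x e) (Lit 1) (Lit 0)"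

primrec TimesE :: "nat \<Rightarrow> hexp \<Rightarrow> hexp" where
  "TimesE 0 e = Lit 0"
| "TimesE (Suc c) e = Add e (TimesE c e)"

lemma heval_connectives [simp]:
  "heval (NotE e) s = of_bool (\<not> 0 < heval e s)"
  "heval (AndE a b) s = of_bool (0 < heval a s \<and> 0 < heval b s)"
  "heval (OrE a b) s = of_bool (0 < heval a s \<or> 0 < heval b s)"
  "heval (EqE a b) s = of_bool (heval a s = heval b s)"
  "heval (ExE x e) s = of_bool (\<exists>k<s ''n'' 0. 0 < heval e (set_var s x k))"
  "0 < heval (LessE a b) s \<longleftrightarrow> heval a s < heval b s"
  by (auto simp: NotE_def AndE_def OrE_def EqE_def ExE_def LessE_def)

lemma heval_Times [simp]: "heval (TimesE c e) s = c * heval e s"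
  by (induction c) auto

lemma names_connectives [simp]:
  "names (NotE e) = names e" "names (AndE a b) = names a \<union> names b" "names (OrE a b) = names a \<union> names b"
  "names (EqE a b) = names a \<union> names b" "names (LessE a b) = names a \<union> names b"
  "names (ExE x e) = insert x (names e)" "names (TimesE c e) = (if c = 0 then {} else names e)"
  subgoal by (auto simp: NotE_def)
  subgoal by (auto simp: AndE_def)
  subgoal by (auto simp: OrE_def)
  subgoal by (auto simp: EqE_def NotE_def)
  subgoal by (auto simp: LessE_def)
  subgoal by (auto simp: ExE_def)
  subgoal by (induction c) auto
  done

lemma binders_connectives [simp]:
  "binders (NotE e) = binders e" "binders (AndE a b) = binders a \<union> binders b"
  "binders (OrE a b) = binders a \<union> binders b" "binders (EqE a b) = binders a \<union> binders b"
  "binders (LessE a b) = binders a \<union> binders b"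
  "binders (ExE x e) = insert x (binders e)" "binders (TimesE c e) = (if c = 0 then {} else binders e)"
  subgoal by (auto simp: NotE_def)
  subgoal by (auto simp: AndE_def)
  subgoal by (auto simp: OrE_def)
  subgoal by (auto simp: EqE_def NotE_def)
  subgoal by (auto simp: LessE_def)
  subgoal by (auto simp: ExE_def)
  subgoal by (induction c) auto
  done

text \<open>A simultaneous assignment \<open>x[v] := e\<close> for all \<open>v < n\<close>. The buffer is needed because \<open>e\<close> may read other
cells of \<open>x\<close>.\<close>

definition Fill :: "vname \<Rightarrow> hexp \<Rightarrow> prog" where
  "Fill x e = Loop ''v'' (Put ''buf'' (Var ''v'') e) ;; Loop ''v'' (Put x (Var ''v'') (Rd ''buf'' (Var ''v'')))"

lemma writes_Fill [simp]: "writes (Fill x e) = {''v'', ''buf'', x}"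
  by (auto simp: Fill_def)

lemma compilable_Fill [simp]: "compilable (Fill x e) \<longleftrightarrow> x \<noteq> ''t'' \<and> x \<noteq> ''n'' \<and> ''t'' \<notin> names e \<and> ''n'' \<notin> binders e"
  by (auto simp: Fill_def)

lemma run_Fill:
  assumes x: "x \<notin> {''v'', ''buf''}" and buf: "''buf'' \<notin> names e"
  shows "run (Fill x e) s x = (\<lambda>i. if i < s ''n'' 0 then heval e (set_var s ''v'' i) else s x i)"
proof -
  have x': "x \<noteq> ''v''" "''v'' \<noteq> x" "x \<noteq> ''buf''" "''buf'' \<noteq> x" using x by auto
  let ?n = "s ''n'' 0"
  define s1 where "s1 = run (Loop ''v'' (Put ''buf'' (Var ''v'') e)) s"
  define I where "I k s' \<longleftrightarrow> (\<forall>i<k. s' ''buf'' i = heval e (set_var s ''v'' i)) \<and>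
    (\<forall>y. y \<notin> {''v'', ''buf''} \<longrightarrow> s' y = s y) \<and> (\<forall>j>0. s' ''v'' j = s ''v'' j)" for k s'
  have "I ?n s1"
    unfolding s1_def
  proof (rule run_Loop_inv)
    fix k s' assume k: "k < ?n" and I: "I k s'"
    have "heval e (set_var s' ''v'' k) = heval e (set_var s ''v'' k)"
    proof (rule heval_cong)
      fix y assume y: "y \<in> insert ''n'' (names e)"
      show "set_var s' ''v'' k y = set_var s ''v'' k y"
      proof (cases "y = ''v''")
        case True
        have "(s' ''v'')(0 := k) = (s ''v'')(0 := k)" using I by (intro ext) (simp add: I_def)
        then show ?thesis using True by simp
      next
        case False
        moreover have "y \<noteq> ''buf''" using y buf by auto
        ultimately show ?thesis using I by (simp add: I_def)
      qed
    qed
    then show "I (Suc k) (run (Put ''buf'' (Var ''v'') e) (set_var s' ''v'' k))"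
      using I by (simp add: I_def less_Suc_eq)
  qed (simp_all add: I_def)
  define J where "J k s' \<longleftrightarrow> (\<forall>i. s' x i = (if i < k then s1 ''buf'' i else s1 x i)) \<and>
    s' ''buf'' = s1 ''buf''" for k s'
  have "J ?n (run (Loop ''v'' (Put x (Var ''v'') (Rd ''buf'' (Var ''v'')))) s1)"
  proof (rule run_Loop_inv)
    fix k s' assume k: "k < ?n" and J: "J k s'"
    then show "J (Suc k) (run (Put x (Var ''v'') (Rd ''buf'' (Var ''v''))) (set_var s' ''v'' k))"
      using x' by (simp add: J_def less_Suc_eq)
  qed (use \<open>I ?n s1\<close> in \<open>simp_all add: J_def I_def\<close>)
  then have "\<forall>i. run (Fill x e) s x i = (if i < ?n then s1 ''buf'' i else s1 x i)"
    by (simp add: J_def Fill_def s1_def)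
  then show ?thesis using \<open>I ?n s1\<close> x by (auto simp: I_def)
qed

text \<open>The last \<open>u < n\<close> that satisfies \<open>P\<close> is stored in \<open>x[v]\<close>, for every \<open>v\<close>. The value \<open>0\<close> stored when the
search fails is still a vertex, so the array may be used as an index in any case.\<close>

definition Search :: "vname \<Rightarrow> hexp \<Rightarrow> prog" where
  "Search x P = Fill x (Lit 0) ;; Loop ''u'' (Fill x (Ite P (Var ''u'') (Rd x (Var ''v''))))"

lemma writes_Search [simp]: "writes (Search x P) = {''v'', ''buf'', ''u'', x}"
  by (auto simp: Search_def)

lemma compilable_Search [simp]:
  "compilable (Search x P) \<longleftrightarrow> x \<noteq> ''t'' \<and> x \<noteq> ''n'' \<and> ''t'' \<notin> names P \<and> ''n'' \<notin> binders P"
  by (auto simp: Search_def)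

text \<open>\<open>P\<close> may depend on everything except the scratch variables of the search and the array being filled. That the
result is the maximum, and not just some solution, makes it a canonical representative when \<open>P\<close>
is an equivalence.\<close>

lemma run_Search:
  assumes x: "x \<notin> {''v'', ''buf'', ''u'', ''n''}" and buf: "''buf'' \<notin> names P"
    and P: "\<And>s'. (\<And>y. y \<notin> {''v'', ''buf'', ''u'', x} \<Longrightarrow> s' y = s y) \<Longrightarrow> s' ''u'' 0 < s ''n'' 0 \<Longrightarrow>
      s' ''v'' 0 < s ''n'' 0 \<Longrightarrow> 0 < heval P s' \<longleftrightarrow> R (s' ''u'' 0) (s' ''v'' 0)"
    and v: "v < s ''n'' 0"
  shows "run (Search x P) s x v =
    (if \<exists>u<s ''n'' 0. R u v then Max {u. u < s ''n'' 0 \<and> R u v} else 0)"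
proof -
  have x': "''v'' \<noteq> x" "''buf'' \<noteq> x" "''u'' \<noteq> x" "''n'' \<noteq> x" using x by auto
  let ?n = "s ''n'' 0"
  define s1 where "s1 = run (Fill x (Lit 0)) s"
  define I where "I k s' \<longleftrightarrow> (\<forall>y. y \<notin> {''v'', ''buf'', ''u'', x} \<longrightarrow> s' y = s y) \<and>
    (\<forall>v<?n. s' x v = (if \<exists>u<k. R u v then Max {u. u < k \<and> R u v} else 0))" for k s'
  have "I ?n (run (Loop ''u'' (Fill x (Ite P (Var ''u'') (Rd x (Var ''v''))))) s1)"
  proof (rule run_Loop_inv)
    show "I 0 s1" using x x' by (simp add: I_def s1_def run_Fill run_frame)
    show "s1 ''n'' 0 = ?n" using x x' by (simp add: s1_def run_frame)
  next
    fix k s' assume k: "k < ?n" and I: "I k s'"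
    let ?s = "set_var s' ''u'' k"
    have n: "s' ''n'' 0 = ?n" using I x x' by (simp add: I_def)
    have "run (Fill x (Ite P (Var ''u'') (Rd x (Var ''v'')))) ?s x v =
        (if \<exists>u<Suc k. R u v then Max {u. u < Suc k \<and> R u v} else 0)" if v: "v < ?n" for v
    proof -
      have P': "0 < heval P (set_var ?s ''v'' v) \<longleftrightarrow> R k v"
        using P[of "set_var ?s ''v'' v"] I k v by (simp add: I_def)
      have set: "{u. u < Suc k \<and> R u v} = (if R k v then insert k {u. u < k \<and> R u v} else {u. u < k \<and> R u v})"
        by (auto simp: less_Suc_eq)
      have Mx: "Max (insert k {u. u < k \<and> R u v}) = k" by (rule Max_eqI) auto
      show ?thesis
      proof (cases "R k v")
        case True
        then have "\<exists>u<Suc k. R u v" by blast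
        then show ?thesis using True P' Mx set x x' buf n v by (simp add: run_Fill)
      next
        case False
        then have ex: "(\<exists>u<Suc k. R u v) \<longleftrightarrow> (\<exists>u<k. R u v)" by (auto simp: less_Suc_eq)
        have "run (Fill x (Ite P (Var ''u'') (Rd x (Var ''v'')))) ?s x v = s' x v"
          using False P' x x' buf n v by (simp add: run_Fill)
        also have "\<dots> = (if \<exists>u<k. R u v then Max {u. u < k \<and> R u v} else 0)"
          using I v unfolding I_def by blast
        finally have val: "run (Fill x (Ite P (Var ''u'') (Rd x (Var ''v'')))) ?s x v = \<dots>" .
        have "{u. u < Suc k \<and> R u v} = {u. u < k \<and> R u v}" using set False by (simp only: if_False)
        then show ?thesis unfolding ex val by (simp only:)
      qed
    qed
    then show "I (Suc k) (run (Fill x (Ite P (Var ''u'') (Rd x (Var ''v'')))) ?s)"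
      using I x x' by (auto simp: I_def run_frame)
  qed
  then show ?thesis using v by (simp add: I_def Search_def s1_def)
qed

text \<open>An arc of a colour class, for \<open>d = False\<close> an arc of its converse. The language has no
multiplication; the offset of a row of the adjacency matrix is the sum of \<open>n\<close> copies of its index.\<close>

definition edge :: "bool \<Rightarrow> hexp \<Rightarrow> hexp \<Rightarrow> hexp" where
  "edge d a b = AndE (Rd ''adj'' (Add (Sum ''w'' (if d then a else b)) (if d then b else a)))
     (EqE (Rd ''colour'' a) (Rd ''colour'' b))"

definition dir :: "bool \<Rightarrow> ('a \<times> 'a) set \<Rightarrow> ('a \<times> 'a) set" where
  "dir d E = (if d then E else E\<inverse>)"

lemma names_edge [simp]: "names (edge d a b) = {''adj'', ''w'', ''colour''} \<union> names a \<union> names b"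
  by (auto simp: edge_def)
lemma binders_edge [simp]: "binders (edge d a b) = {''w''} \<union> binders a \<union> binders b"
  by (auto simp: edge_def)

lemma scc_dir [simp]: "scc (dir d E) r = scc E r"
  by (simp add: dir_def)
lemma layer_dir [simp]: "layer (dir d E) r f x = layer E r f x"
  by (simp add: layer_def)

definition colour_arcs :: "nat \<Rightarrow> (nat \<Rightarrow> nat) \<Rightarrow> (nat \<Rightarrow> nat) \<Rightarrow> (nat \<times> nat) set" where
  "colour_arcs N A C = {(u, v). u < N \<and> v < N \<and> 0 < A (N * u + v) \<and> C u = C v}"

text \<open>The array \<open>x\<close> runs through the values of \<open>bfs\<close> round by round.\<close>

definition levels :: "bool \<Rightarrow> vname \<Rightarrow> prog" where
  "levels d x = Fill x (EqE (Var ''v'') (Var ''r'')) ;;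
     Loop ''k'' (Fill x (Ite (OrE (Rd x (Var ''v'')) (ExE ''u'' (AndE (Rd x (Var ''u'')) (edge d (Var ''u'') (Var ''v'')))))
       (Add (Rd x (Var ''v'')) (Lit 1)) (Lit 0)))"

text \<open>The arrays \<open>lf\<close> and \<open>pf\<close> belong to the forward direction, \<open>lb\<close> and \<open>pb\<close> to the backward
direction.\<close>

definition level_array :: "bool \<Rightarrow> vname" where "level_array d = (if d then ''lf'' else ''lb'')"
definition label_array :: "bool \<Rightarrow> vname" where "label_array d = (if d then ''pf'' else ''pb'')"

text \<open>A vertex is in the component of \<open>r\<close> if and only if both its levels are nonzero.\<close>

definition same_layer :: "bool \<Rightarrow> hexp \<Rightarrow> hexp \<Rightarrow> hexp" where
  "same_layer d a b = AndE (AndE (Rd ''lf'' a) (Rd ''lb'' a)) (EqE (Rd (level_array d) a) (Rd (level_array d) b))"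

lemma names_same_layer [simp]: "names (same_layer d a b) = {''lf'', ''lb''} \<union> names a \<union> names b"
  by (auto simp: same_layer_def level_array_def)
lemma binders_same_layer [simp]: "binders (same_layer d a b) = binders a \<union> binders b"
  by (auto simp: same_layer_def level_array_def)

definition arc_in_layer :: "bool \<Rightarrow> hexp" where
  "arc_in_layer d = AndE (same_layer d (Var ''u'') (Var ''v'')) (edge d (Var ''u'') (Var ''v''))"

lemma names_arc_in_layer [simp]:
  "names (arc_in_layer d) = {''lf'', ''lb'', ''u'', ''v'', ''adj'', ''w'', ''colour''}"
  by (auto simp: arc_in_layer_def)
lemma binders_arc_in_layer [simp]: "binders (arc_in_layer d) = {''w''}"
  by (auto simp: arc_in_layer_def)

text \<open>The two scans of \<open>quasi_kernel\<close>, carried out for all layers at once. Cells at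
later indices are still zero, so the quantifier finds earlier vertices only.\<close>

definition select_greedily :: "bool \<Rightarrow> prog" where
  "select_greedily d = Fill ''sel'' (Lit 0) ;;
     Loop ''v'' (Put ''sel'' (Var ''v'') (NotE (ExE ''u'' (AndE (Rd ''sel'' (Var ''u'')) (arc_in_layer d)))))"

text \<open>The scan descends, with index \<open>n - 1 - k\<close>.\<close>

definition kernel :: "bool \<Rightarrow> prog" where
  "kernel d = Fill ''ker'' (Lit 0) ;;
     Loop ''k'' (Put ''v'' (Lit 0) (Sub (Sub (Var ''n'') (Lit 1)) (Var ''k'')) ;;
       Put ''ker'' (Var ''v'') (AndE (Rd ''sel'' (Var ''v''))
         (NotE (ExE ''u'' (AndE (Rd ''ker'' (Var ''u'')) (arc_in_layer d))))))"

definition parents :: "bool \<Rightarrow> prog" where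
  "parents d = Search ''par'' (AndE (edge d (Var ''u'') (Var ''v''))
     (EqE (Rd (level_array d) (Var ''u'')) (Add (Rd (level_array d) (Var ''v'')) (Lit 1))))"

lemma level_array_neq [simp]: "level_array d \<noteq> ''buf''" "''buf'' \<noteq> level_array d" "level_array d \<noteq> ''t''" "''t'' \<noteq> level_array d" "level_array d \<noteq> ''v''" "level_array d \<noteq> ''u''"
  by (auto simp: level_array_def)

definition witnesses :: "bool \<Rightarrow> prog" where
  "witnesses d = Search ''wit'' (AndE (Rd ''ker'' (Var ''u'')) (AndE (same_layer d (Var ''u'') (Var ''v''))
     (NotE (edge d (Var ''v'') (Var ''u'')))))"

definition kind :: "bool \<Rightarrow> hexp" where
  "kind d = (let v = Var ''v''; t = Rd ''wit'' (Var ''v''); q = Rd ''par'' (Rd ''wit'' (Var ''v'')) in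
     Ite (OrE (edge d v t) (edge d t v)) (Ite (OrE (edge d v q) (edge d q v)) (Lit 2) (Lit 1)) (Lit 0))"

definition label :: "bool \<Rightarrow> prog" where
  "label d = Fill (label_array d) (Add (TimesE 12 (Sum ''u'' (AndE (Rd ''ker'' (Var ''u''))
         (AndE (same_layer d (Var ''u'') (Var ''v'')) (LessE (Var ''u'') (Rd ''wit'' (Var ''v'')))))))
     (Add (TimesE 4 (kind d))
       (TimesE 2 (ExE ''u'' (EqE (Add (Add (Var ''u'') (Var ''u'')) (Lit 1)) (Rd (level_array d) (Var ''v'')))))))"

lemma names_kind [simp]: "names (kind d) = {''adj'', ''w'', ''colour'', ''v'', ''wit'', ''par''}"
  by (auto simp: kind_def Let_def)
lemma binders_kind [simp]: "binders (kind d) = {''w''}"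
  by (auto simp: kind_def Let_def)

definition pass :: "bool \<Rightarrow> prog" where
  "pass d = select_greedily d ;; kernel d ;; parents d ;; witnesses d ;; label d"

lemma writes_pass_parts [simp]:
  "writes (select_greedily d) = {''v'', ''buf'', ''sel''}" "writes (kernel d) = {''v'', ''buf'', ''k'', ''ker''}"
  "writes (parents d) = {''v'', ''buf'', ''u'', ''par''}" "writes (witnesses d) = {''v'', ''buf'', ''u'', ''wit''}"
  "writes (label d) = {''v'', ''buf'', label_array d}"
  by (auto simp: select_greedily_def kernel_def parents_def witnesses_def label_def)

lemma Max_choice:
  assumes "\<exists>u<n. R u" shows "Max {u. u < n \<and> R u} < n" "R (Max {u. u < n \<and> R (u :: nat)})"
proof -
  have "Max {u. u < n \<and> R u} \<in> {u. u < n \<and> R u}" using assms by (intro Max_in) auto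
  then show "Max {u. u < n \<and> R u} < n" "R (Max {u. u < n \<and> R u})" by auto
qed

text \<open>Only the component of \<open>r\<close> is relabelled. Level \<open>n\<close> holds the out-neighbours of \<open>r\<close>; they take the label
of the backward direction.\<close>

definition relabel :: prog where
  "relabel = Fill ''lab'' (Ite (AndE (Rd ''lf'' (Var ''v'')) (Rd ''lb'' (Var ''v'')))
     (Ite (EqE (Rd ''lf'' (Var ''v'')) (Var ''n'')) (Add (Rd ''pb'' (Var ''v'')) (Lit 1)) (Rd ''pf'' (Var ''v'')))
     (Rd ''lab'' (Var ''v'')))"

definition component :: prog where
  "component = levels True ''lf'' ;; levels False ''lb'' ;; pass True ;; pass False ;; relabel"

text \<open>Every vertex serves as \<open>r\<close>, so each component is relabelled once for each of its vertices and keeps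
the labels of the last one. The pair of old colour and label is encoded as the last vertex that has
this pair.\<close>

definition refine_round :: prog where
  "refine_round = Loop ''r'' component ;;
     Search ''rep'' (AndE (EqE (Rd ''colour'' (Var ''u'')) (Rd ''colour'' (Var ''v'')))
       (EqE (Rd ''lab'' (Var ''u'')) (Rd ''lab'' (Var ''v'')))) ;;
     Fill ''colour'' (Rd ''rep'' (Var ''v''))"

text \<open>Once the classes are acyclic, further rounds leave the partition as it is. So \<open>n\<close> rounds stand in for
the unknown independence number, which is at most \<open>n\<close>.\<close>

definition algorithm :: prog where
  "algorithm = Loop ''i'' refine_round"

lemma writes_levels [simp]: "writes (levels d x) = {''v'', ''buf'', ''k'', x}"
  by (auto simp: levels_def)

lemma writes_pass [simp]: "writes (pass d) =
    {''v'', ''buf'', ''sel'', ''k'', ''ker'', ''u'', ''par'', ''wit'', label_array d}"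
  by (auto simp: pass_def)

lemma writes_component: "writes component = {''v'', ''buf'', ''k'', ''lf'', ''lb'', ''sel'', ''ker'', ''u'',
    ''par'', ''wit'', ''pf'', ''pb'', ''lab''}"
  by (auto simp: component_def relabel_def label_array_def)

lemma compilable_algorithm: "compilable algorithm"
  by (simp add: algorithm_def refine_round_def component_def relabel_def pass_def levels_def select_greedily_def kernel_def
      parents_def witnesses_def label_def level_array_def label_array_def)

lemma dir_simps [simp]: "dir True E = E" "dir False E = E\<inverse>"
  by (simp_all add: dir_def)

text \<open>The number of vertices, the adjacency matrix and the colouring, all of which stay the same until the end of a
round.\<close>

locale round_context =
  fixes N :: nat and A C :: "nat \<Rightarrow> nat"
begin

abbreviation "E \<equiv> colour_arcs N A C"

definition base :: "state \<Rightarrow> bool" where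
  "base s \<longleftrightarrow> s ''n'' 0 = N \<and> s ''adj'' = A \<and> s ''colour'' = C"

lemma E_sub: "E \<subseteq> {..<N} \<times> {..<N}" by (auto simp: colour_arcs_def)

lemma dir_E_sub: "dir d E \<subseteq> {..<N} \<times> {..<N}" by (auto simp: colour_arcs_def dir_def)

lemma scc_lt: "v \<in> scc E r \<Longrightarrow> r < N \<Longrightarrow> v < N"
proof -
  assume "v \<in> scc E r" "r < N"
  then have "(r, v) \<in> E\<^sup>*" by (simp add: scc_def)
  then show ?thesis using \<open>r < N\<close> by (cases rule: rtranclE) (use E_sub in auto)
qed

lemma heval_edge:
  assumes "base s" "''w'' \<notin> names a" "''w'' \<notin> names b" "heval a s < N" "heval b s < N"
  shows "0 < heval (edge d a b) s \<longleftrightarrow> (heval a s, heval b s) \<in> dir d E"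
proof -
  have w: "heval a (set_var s ''w'' k) = heval a s" "heval b (set_var s ''w'' k) = heval b s" for k
    using assms(2,3) by (auto intro!: heval_cong)
  show ?thesis
    using assms by (cases d) (auto simp: edge_def dir_def colour_arcs_def base_def w)
qed

lemma run_levels:
  assumes s: "base s" "s ''r'' 0 = r"
    and x: "x \<notin> {''n'', ''adj'', ''colour'', ''u'', ''v'', ''w'', ''k'', ''r'', ''buf''}"
    and v: "v < N"
  shows "run (levels d x) s x v = bfs (dir d E) r N v"
proof -
  have x': "''n'' \<noteq> x" "''adj'' \<noteq> x" "''colour'' \<noteq> x" "''u'' \<noteq> x" "''v'' \<noteq> x" "''w'' \<noteq> x"
    "''k'' \<noteq> x" "''r'' \<noteq> x" "''buf'' \<noteq> x" using x by auto
  let ?init = "Fill x (EqE (Var ''v'') (Var ''r''))"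
  let ?step = "Fill x (Ite (OrE (Rd x (Var ''v'')) (ExE ''u'' (AndE (Rd x (Var ''u'')) (edge d (Var ''u'') (Var ''v'')))))
       (Add (Rd x (Var ''v'')) (Lit 1)) (Lit 0))"
  define I where "I k s' \<longleftrightarrow> base s' \<and> (\<forall>v<N. s' x v = bfs (dir d E) r k v)" for k s'
  have "I N (run (Loop ''k'' ?step) (run ?init s))"
  proof (rule run_Loop_inv)
    show "I 0 (run ?init s)"
      using s x x' by (simp add: I_def base_def run_frame run_Fill)
    show "run ?init s ''n'' 0 = N"
      using s x x' by (simp add: base_def run_frame)
  next
    fix k s' assume k: "k < N" and I: "I k s'"
    let ?s = "set_var s' ''k'' k"
    have b: "base ?s" "s' ''n'' 0 = N" using I by (simp_all add: I_def base_def)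
    have "run ?step ?s x v = bfs (dir d E) r (Suc k) v" if v: "v < N" for v
    proof -
      have e: "0 < heval (edge d (Var ''u'') (Var ''v'')) (set_var (set_var ?s ''v'' v) ''u'' u) \<longleftrightarrow> (u, v) \<in> dir d E"
        if "u < N" for u
        using heval_edge[of "set_var (set_var ?s ''v'' v) ''u'' u" "Var ''u''" "Var ''v''" d] b(1) that v
        by (simp add: base_def)
      have "(\<exists>u<N. 0 < s' x u \<and> (u, v) \<in> dir d E) \<longleftrightarrow> (\<exists>u. 0 < bfs (dir d E) r k u \<and> (u, v) \<in> dir d E)"
      proof -
        have "u < N" if "(u, v) \<in> dir d E" for u using dir_E_sub[of d] that by blast
        moreover have "s' x u = bfs (dir d E) r k u" if "u < N" for u using I that by (simp add: I_def)
        ultimately show ?thesis by metis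
      qed
      then show ?thesis
        using x x' I v b e by (simp add: run_Fill I_def cong: conj_cong)
    qed
    moreover have "base (run ?step ?s)" using b x x' by (simp add: base_def run_frame)
    ultimately show "I (Suc k) (run ?step ?s)" by (simp add: I_def)
  qed
  then show ?thesis using v by (simp add: I_def levels_def)
qed

text \<open>What the program parts of one direction rely on: both level arrays are known, so that membership in the
component can be tested, and \<open>f\<close> is the level function of direction \<open>d\<close>.\<close>

definition pass_ctx :: "bool \<Rightarrow> nat \<Rightarrow> (nat \<Rightarrow> nat) \<Rightarrow> state \<Rightarrow> bool" where
  "pass_ctx d r f s \<longleftrightarrow> base s \<and> s ''r'' 0 = r \<and> r < N \<and>
     (\<forall>u<N. 0 < s ''lf'' u \<and> 0 < s ''lb'' u \<longleftrightarrow> u \<in> scc E r) \<and> (\<forall>u<N. s (level_array d) u = f u)"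

lemma pass_ctx_frame:
  assumes "pass_ctx d r f s" "\<And>y. y \<in> {''n'', ''adj'', ''colour'', ''r'', ''lf'', ''lb''} \<Longrightarrow> s' y = s y"
  shows "pass_ctx d r f s'"
  using assms by (simp add: pass_ctx_def base_def level_array_def)

lemma pass_ctxD:
  assumes "pass_ctx d r f s"
  shows "base s" "s ''n'' 0 = N" "r < N" "u < N \<Longrightarrow> s (level_array d) u = f u"
  using assms by (simp_all add: pass_ctx_def base_def)

lemma heval_same_layer:
  assumes "pass_ctx d r f s" "heval a s < N" "heval b s < N"
  shows "0 < heval (same_layer d a b) s \<longleftrightarrow> heval a s \<in> layer E r f (heval b s)"
  using assms by (simp add: same_layer_def pass_ctx_def layer_def)

lemma heval_arc_in_layer:
  assumes "pass_ctx d r f s" "s ''u'' 0 < N" "s ''v'' 0 < N"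
  shows "0 < heval (arc_in_layer d) s \<longleftrightarrow>
    s ''u'' 0 \<in> layer E r f (s ''v'' 0) \<and> (s ''u'' 0, s ''v'' 0) \<in> dir d E"
  using heval_same_layer[OF assms(1), of "Var ''u''" "Var ''v''"]
    heval_edge[OF pass_ctxD(1)[OF assms(1)], of "Var ''u''" "Var ''v''" d] assms(2,3)
  by (simp add: arc_in_layer_def)

lemma run_select_greedily:
  assumes s: "pass_ctx d r f s" and v: "v < N"
  shows "0 < run (select_greedily d) s ''sel'' v \<longleftrightarrow>
    \<not> (\<exists>u<v. 0 < run (select_greedily d) s ''sel'' u \<and> u \<in> layer E r f v \<and> (u, v) \<in> dir d E)"
proof -
  let ?init = "Fill ''sel'' (Lit 0)"
  let ?step = "Put ''sel'' (Var ''v'') (NotE (ExE ''u'' (AndE (Rd ''sel'' (Var ''u'')) (arc_in_layer d))))"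
  define I where "I k s' \<longleftrightarrow> pass_ctx d r f s' \<and> (\<forall>v<N. k \<le> v \<longrightarrow> s' ''sel'' v = 0) \<and>
    (\<forall>v<k. 0 < s' ''sel'' v \<longleftrightarrow>
      \<not> (\<exists>u<v. 0 < s' ''sel'' u \<and> u \<in> layer E r f v \<and> (u, v) \<in> dir d E))" for k s'
  have "I N (run (Loop ''v'' ?step) (run ?init s))"
  proof (rule run_Loop_inv)
    have "pass_ctx d r f (run ?init s)" using s by (rule pass_ctx_frame) (auto simp: run_frame)
    then show "I 0 (run ?init s)" "run ?init s ''n'' 0 = N"
      using pass_ctxD(2)[OF s] pass_ctxD(2) by (auto simp: I_def run_Fill)
  next
    fix k s' assume k: "k < N" and I: "I k s'"
    let ?s = "set_var s' ''v'' k"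
    have ctx: "pass_ctx d r f s'" "s' ''n'' 0 = N" using I pass_ctxD(2) by (auto simp: I_def)
    have e: "0 < heval (arc_in_layer d) (set_var ?s ''u'' u) \<longleftrightarrow> u \<in> layer E r f k \<and> (u, k) \<in> dir d E"
      if "u < N" for u
    proof -
      have "pass_ctx d r f (set_var ?s ''u'' u)" using ctx(1) by (rule pass_ctx_frame) auto
      from heval_arc_in_layer[OF this] that k show ?thesis by simp
    qed
    have lt: "u < k" if "u < N" "0 < s' ''sel'' u" for u
      using I that by (metis I_def leI less_numeral_extra(3))
    have "(\<exists>u<N. 0 < s' ''sel'' u \<and> 0 < heval (arc_in_layer d) (set_var ?s ''u'' u)) \<longleftrightarrow>
        (\<exists>u<k. 0 < s' ''sel'' u \<and> u \<in> layer E r f k \<and> (u, k) \<in> dir d E)"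
      using e lt k by (meson less_trans)
    then have val: "run ?step ?s ''sel'' = (s' ''sel'')
        (k := of_bool (\<not> (\<exists>u<k. 0 < s' ''sel'' u \<and> u \<in> layer E r f k \<and> (u, k) \<in> dir d E)))"
      using ctx(2) by simp
    have "pass_ctx d r f (run ?step ?s)" using ctx(1) by (rule pass_ctx_frame) auto
    then show "I (Suc k) (run ?step ?s)"
      using I unfolding I_def val by (auto simp: less_Suc_eq)
  qed
  then show ?thesis using v unfolding I_def select_greedily_def by simp
qed

lemma run_kernel:
  assumes s: "pass_ctx d r f s" and v: "v < N"
  shows "0 < run (kernel d) s ''ker'' v \<longleftrightarrow> 0 < s ''sel'' v \<and>
    \<not> (\<exists>u<N. v < u \<and> 0 < run (kernel d) s ''ker'' u \<and> u \<in> layer E r f v \<and> (u, v) \<in> dir d E)"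
proof -
  let ?init = "Fill ''ker'' (Lit 0)"
  let ?step = "Put ''v'' (Lit 0) (Sub (Sub (Var ''n'') (Lit 1)) (Var ''k'')) ;;
       Put ''ker'' (Var ''v'') (AndE (Rd ''sel'' (Var ''v''))
         (NotE (ExE ''u'' (AndE (Rd ''ker'' (Var ''u'')) (arc_in_layer d)))))"
  define I where "I k s' \<longleftrightarrow> pass_ctx d r f s' \<and> s' ''sel'' = s ''sel'' \<and> (\<forall>v<N - k. s' ''ker'' v = 0) \<and>
    (\<forall>v<N. N - k \<le> v \<longrightarrow> (0 < s' ''ker'' v \<longleftrightarrow> 0 < s ''sel'' v \<and>
      \<not> (\<exists>u<N. v < u \<and> 0 < s' ''ker'' u \<and> u \<in> layer E r f v \<and> (u, v) \<in> dir d E)))" for k s'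
  have "I N (run (Loop ''k'' ?step) (run ?init s))"
  proof (rule run_Loop_inv)
    have "pass_ctx d r f (run ?init s)" using s by (rule pass_ctx_frame) (auto simp: run_frame)
    then show "I 0 (run ?init s)" "run ?init s ''n'' 0 = N"
      using pass_ctxD(2)[OF s] pass_ctxD(2) by (auto simp: I_def run_Fill run_frame)
  next
    fix k s' assume k: "k < N" and I: "I k s'"
    define p where "p = N - Suc k"
    have p: "p < N" "N - k = Suc p" "N - Suc k = p" using k by (auto simp: p_def)
    have ctx: "pass_ctx d r f s'" "s' ''n'' 0 = N" using I pass_ctxD(2) by (auto simp: I_def)
    define t where "t = set_var (set_var s' ''k'' k) ''v'' p"
    have t: "run (Put ''v'' (Lit 0) (Sub (Sub (Var ''n'') (Lit 1)) (Var ''k''))) (set_var s' ''k'' k) = t"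
      using ctx(2) by (simp add: t_def p_def set_var_def)
    have tctx: "pass_ctx d r f t" using ctx(1) by (rule pass_ctx_frame) (auto simp: t_def)
    have e: "0 < heval (arc_in_layer d) (set_var t ''u'' u) \<longleftrightarrow> u \<in> layer E r f p \<and> (u, p) \<in> dir d E"
      if "u < N" for u
    proof -
      have "pass_ctx d r f (set_var t ''u'' u)" using tctx by (rule pass_ctx_frame) auto
      from heval_arc_in_layer[OF this] that p(1) show ?thesis by (simp add: t_def)
    qed
    have gt: "p < u" if "u < N" "0 < s' ''ker'' u" for u
      using I that p(2) unfolding I_def by (metis less_numeral_extra(3) not_less_eq)
    have "(\<exists>u<N. 0 < s' ''ker'' u \<and> 0 < heval (arc_in_layer d) (set_var t ''u'' u)) \<longleftrightarrow>
        (\<exists>u<N. p < u \<and> 0 < s' ''ker'' u \<and> u \<in> layer E r f p \<and> (u, p) \<in> dir d E)"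
      using e gt by meson
    moreover define K where "K = (s' ''ker'')(p := of_bool (0 < s ''sel'' p \<and>
           \<not> (\<exists>u<N. p < u \<and> 0 < s' ''ker'' u \<and> u \<in> layer E r f p \<and> (u, p) \<in> dir d E)))"
    ultimately have val: "run ?step (set_var s' ''k'' k) ''ker'' = K"
      using I ctx(2) unfolding run.simps(2) t by (simp add: t_def I_def)
    have K_above: "K u = s' ''ker'' u" if "p < u" for u using that by (simp add: K_def)
    have ex: "(\<exists>u<N. v < u \<and> 0 < K u \<and> u \<in> layer E r f v \<and> (u, v) \<in> dir d E) \<longleftrightarrow>
        (\<exists>u<N. v < u \<and> 0 < s' ''ker'' u \<and> u \<in> layer E r f v \<and> (u, v) \<in> dir d E)" if "p \<le> v" for v
      using K_above[OF le_less_trans[OF that]] by (intro iff_exI) auto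
    have "0 < K v \<longleftrightarrow> 0 < s ''sel'' v \<and>
      \<not> (\<exists>u<N. v < u \<and> 0 < K u \<and> u \<in> layer E r f v \<and> (u, v) \<in> dir d E)" if "v < N" "p \<le> v" for v
    proof (cases "v = p")
      case True
      have "0 < K p \<longleftrightarrow> 0 < s ''sel'' p \<and>
           \<not> (\<exists>u<N. p < u \<and> 0 < s' ''ker'' u \<and> u \<in> layer E r f p \<and> (u, p) \<in> dir d E)"
        unfolding K_def fun_upd_same by (rule zero_less_of_bool_iff)
      then show ?thesis unfolding True ex[OF order_refl] .
    next
      case False
      then have "p < v" using that by simp
      then show ?thesis using I that ex[of v] K_above[of v] p(2) unfolding I_def by (simp add: Suc_le_eq)
    qed
    moreover have "K v = 0" if "v < p" for v using I that p(2) unfolding I_def K_def by simp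
    moreover have "pass_ctx d r f (run ?step (set_var s' ''k'' k))"
      using ctx(1) by (rule pass_ctx_frame) auto
    moreover have "run ?step (set_var s' ''k'' k) ''sel'' = s ''sel''" using I by (simp add: I_def)
    ultimately show "I (Suc k) (run ?step (set_var s' ''k'' k))"
      unfolding I_def val p(3) by blast
  qed
  then show ?thesis using v unfolding I_def kernel_def by simp
qed

lemma run_parents:
  assumes s: "pass_ctx d r f s" and v: "v < N"
  shows "run (parents d) s ''par'' v < N"
    "\<exists>u. (u, v) \<in> dir d E \<and> f u = Suc (f v) \<Longrightarrow>
      (run (parents d) s ''par'' v, v) \<in> dir d E \<and> f (run (parents d) s ''par'' v) = Suc (f v)"
proof -
  let ?P = "AndE (edge d (Var ''u'') (Var ''v'')) (EqE (Rd (level_array d) (Var ''u'')) (Add (Rd (level_array d) (Var ''v'')) (Lit 1)))"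
  let ?R = "\<lambda>u v. (u, v) \<in> dir d E \<and> f u = Suc (f v)"
  have n: "s ''n'' 0 = N" using pass_ctxD(2)[OF s] .
  have "run (parents d) s ''par'' v =
      (if \<exists>u<s ''n'' 0. ?R u v then Max {u. u < s ''n'' 0 \<and> ?R u v} else 0)"
    unfolding parents_def
  proof (rule run_Search[where R = ?R])
    fix s' :: state
    assume fr: "\<And>y. y \<notin> {''v'', ''buf'', ''u'', ''par''} \<Longrightarrow> s' y = s y"
      and "s' ''u'' 0 < s ''n'' 0" "s' ''v'' 0 < s ''n'' 0"
    then have lt: "s' ''u'' 0 < N" "s' ''v'' 0 < N" using n by simp_all
    have c: "pass_ctx d r f s'" using s by (rule pass_ctx_frame) (auto intro: fr)
    show "0 < heval ?P s' \<longleftrightarrow> ?R (s' ''u'' 0) (s' ''v'' 0)"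
      using heval_edge[OF pass_ctxD(1)[OF c], of "Var ''u''" "Var ''v''" d] lt
        pass_ctxD(4)[OF c lt(1)] pass_ctxD(4)[OF c lt(2)] by simp
  qed (use v n in auto)
  then have val: "run (parents d) s ''par'' v = (if \<exists>u<N. ?R u v then Max {u. u < N \<and> ?R u v} else 0)"
    unfolding n .
  show "run (parents d) s ''par'' v < N"
    unfolding val using Max_choice(1)[of N "\<lambda>u. ?R u v"] v by (cases "\<exists>u<N. ?R u v") auto
  assume "\<exists>u. ?R u v"
  then have "\<exists>u<N. ?R u v" using dir_E_sub[of d] by blast
  from Max_choice(2)[OF this] this show "?R (run (parents d) s ''par'' v) v" unfolding val by simp
qed

lemma run_witnesses:
  assumes s: "pass_ctx d r f s" and v: "v < N"
  shows "run (witnesses d) s ''wit'' v < N"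
    "\<exists>u. u < N \<and> 0 < s ''ker'' u \<and> u \<in> layer E r f v \<and> (v, u) \<notin> dir d E \<Longrightarrow>
      0 < s ''ker'' (run (witnesses d) s ''wit'' v) \<and> run (witnesses d) s ''wit'' v \<in> layer E r f v \<and>
      (v, run (witnesses d) s ''wit'' v) \<notin> dir d E"
proof -
  let ?P = "AndE (Rd ''ker'' (Var ''u'')) (AndE (same_layer d (Var ''u'') (Var ''v'')) (NotE (edge d (Var ''v'') (Var ''u''))))"
  let ?R = "\<lambda>u v. 0 < s ''ker'' u \<and> u \<in> layer E r f v \<and> (v, u) \<notin> dir d E"
  have n: "s ''n'' 0 = N" using pass_ctxD(2)[OF s] .
  have "run (witnesses d) s ''wit'' v =
      (if \<exists>u<s ''n'' 0. ?R u v then Max {u. u < s ''n'' 0 \<and> ?R u v} else 0)"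
    unfolding witnesses_def
  proof (rule run_Search[where R = ?R])
    fix s' :: state
    assume fr: "\<And>y. y \<notin> {''v'', ''buf'', ''u'', ''wit''} \<Longrightarrow> s' y = s y"
      and "s' ''u'' 0 < s ''n'' 0" "s' ''v'' 0 < s ''n'' 0"
    then have lt: "s' ''u'' 0 < N" "s' ''v'' 0 < N" using n by simp_all
    have c: "pass_ctx d r f s'" using s by (rule pass_ctx_frame) (auto intro: fr)
    have k: "s' ''ker'' = s ''ker''" by (rule fr) simp
    show "0 < heval ?P s' \<longleftrightarrow> ?R (s' ''u'' 0) (s' ''v'' 0)"
      using heval_edge[OF pass_ctxD(1)[OF c], of "Var ''v''" "Var ''u''" d]
        heval_same_layer[OF c, of "Var ''u''" "Var ''v''"] lt by (simp add: k)
  qed (use v n in auto)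
  then have val: "run (witnesses d) s ''wit'' v = (if \<exists>u<N. ?R u v then Max {u. u < N \<and> ?R u v} else 0)"
    unfolding n .
  show "run (witnesses d) s ''wit'' v < N"
    unfolding val using Max_choice(1)[of N "\<lambda>u. ?R u v"] v by (cases "\<exists>u<N. ?R u v") auto
  assume "\<exists>u. u < N \<and> ?R u v"
  from Max_choice(2)[OF this] this show "?R (run (witnesses d) s ''wit'' v) v" unfolding val by simp
qed

lemma heval_kind:
  assumes c: "pass_ctx d r f s" and lt: "s ''v'' 0 < N" "\<And>v. v < N \<Longrightarrow> s ''wit'' v < N" "\<And>v. v < N \<Longrightarrow> s ''par'' v < N"
  shows "heval (kind d) s = witness_kind (dir d E) (s ''par'') (s ''wit'' (s ''v'' 0)) (s ''v'' 0)"
proof -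
  note b = pass_ctxD(1)[OF c]
  let ?v = "Var ''v''" and ?t = "Rd ''wit'' (Var ''v'')" and ?q = "Rd ''par'' (Rd ''wit'' (Var ''v''))"
  show ?thesis
    using heval_edge[OF b, of ?v ?t d] heval_edge[OF b, of ?t ?v d] heval_edge[OF b, of ?v ?q d]
      heval_edge[OF b, of ?q ?v d] lt
    by (simp add: kind_def witness_kind_def Let_def)
qed

text \<open>The bound on \<open>m\<close> is that of a level. It makes \<open>n\<close> candidates for half of \<open>m - 1\<close> sufficient.\<close>

lemma parity_witness:
  assumes "m \<le> Suc N" "0 < N"
  shows "of_bool (\<exists>k<N. Suc (k + k) = m) = m mod 2"
proof (cases "odd m")
  case True
  then obtain k where "m = 2 * k + 1" by (elim oddE)
  moreover from this have "k < N" using assms by linarith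
  ultimately have "\<exists>k<N. Suc (k + k) = m" by auto
  then show ?thesis using True by (simp add: odd_iff_mod_2_eq_one)
next
  case False
  then have "\<not> (\<exists>k<N. Suc (k + k) = m)" by auto
  then show ?thesis using False by (simp add: even_iff_mod_2_eq_zero)
qed

lemma run_label:
  assumes c: "pass_ctx d r f s" and v: "v < N" and f: "f v \<le> Suc N"
    and lt: "\<And>v. v < N \<Longrightarrow> s ''wit'' v < N" "\<And>v. v < N \<Longrightarrow> s ''par'' v < N"
  shows "run (label d) s (label_array d) v =
    pass_label (dir d E) r f (s ''par'') {v. v < N \<and> 0 < s ''ker'' v} (s ''wit'') v"
proof -
  let ?s = "set_var s ''v'' v"
  have cv: "pass_ctx d r f ?s" using c by (rule pass_ctx_frame) auto
  have k: "heval (kind d) ?s = witness_kind (dir d E) (s ''par'') (s ''wit'' v) v"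
    using heval_kind[OF cv] v lt by simp
  have g: "0 < heval (same_layer d (Var ''u'') (Var ''v'')) (set_var ?s ''u'' u) \<longleftrightarrow> u \<in> layer E r f v" if "u < N" for u
  proof -
    have "pass_ctx d r f (set_var ?s ''u'' u)" using cv by (rule pass_ctx_frame) auto
    from heval_same_layer[OF this, of "Var ''u''" "Var ''v''"] that v show ?thesis by simp
  qed
  have n: "s ''n'' 0 = N" using pass_ctxD(2)[OF c] .
  have "(\<Sum>u<N. heval (AndE (Rd ''ker'' (Var ''u'')) (AndE (same_layer d (Var ''u'') (Var ''v''))
      (LessE (Var ''u'') (Rd ''wit'' (Var ''v''))))) (set_var ?s ''u'' u)) =
      (\<Sum>u<N. of_bool (0 < s ''ker'' u \<and> u \<in> layer E r f v \<and> u < s ''wit'' v))"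
    by (rule sum.cong) (use g in auto)
  also have "\<dots> = card {t \<in> {v. v < N \<and> 0 < s ''ker'' v} \<inter> layer E r f v. t < s ''wit'' v}"
    by (simp add: sum_of_bool_eq Collect_conj_eq Int_ac lessThan_def)
  finally have sum: "(\<Sum>u<N. heval (AndE (Rd ''ker'' (Var ''u'')) (AndE (same_layer d (Var ''u'') (Var ''v''))
      (LessE (Var ''u'') (Rd ''wit'' (Var ''v''))))) (set_var ?s ''u'' u)) = \<dots>" .
  have par: "heval (ExE ''u'' (EqE (Add (Add (Var ''u'') (Var ''u'')) (Lit 1)) (Rd (level_array d) (Var ''v'')))) ?s = f v mod 2"
    using parity_witness[OF f] v n pass_ctxD(4)[OF c v] by (simp add: set_var_def)
  have fresh: "label_array d \<notin> {''v'', ''buf''}" by (simp add: label_array_def)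
  have "''buf'' \<notin> names (Add (TimesE 12 (Sum ''u'' (AndE (Rd ''ker'' (Var ''u''))
         (AndE (same_layer d (Var ''u'') (Var ''v'')) (LessE (Var ''u'') (Rd ''wit'' (Var ''v'')))))))
     (Add (TimesE 4 (kind d))
       (TimesE 2 (ExE ''u'' (EqE (Add (Add (Var ''u'') (Var ''u'')) (Lit 1)) (Rd (level_array d) (Var ''v'')))))))"
    by simp
  from run_Fill[OF fresh this, of s] show ?thesis
    unfolding label_def pass_label_def using v n sum k par by (simp only: heval.simps heval_Times) simp
qed

lemma dir_free: "C3_free_rel E \<Longrightarrow> C3_free_rel (dir d E)"
  by (simp add: dir_def C3_free_rel_converse)

text \<open>The witness exists by \<open>quasi_kernel\<close> and the parent by the properties of levels; the remaining work is to
identify the memory contents with the sets and functions there.\<close>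

lemma run_pass:
  assumes free: "C3_free_rel E" and s: "pass_ctx d r f s" and lev: "is_level (dir d E) N r f"
  shows "\<exists>p Q wit. pass_ok (dir d E) N r f p Q wit \<and>
    (\<forall>v\<in>scc E r. run (pass d) s (label_array d) v = pass_label (dir d E) r f p Q wit v)"
proof -
  define s1 where "s1 = run (select_greedily d) s"
  define s2 where "s2 = run (kernel d) s1"
  define s3 where "s3 = run (parents d) s2"
  define s4 where "s4 = run (witnesses d) s3"
  have c: "pass_ctx d r f s1" "pass_ctx d r f s2" "pass_ctx d r f s3" "pass_ctx d r f s4"
    using s by (auto elim!: pass_ctx_frame simp: s1_def s2_def s3_def s4_def run_frame)
  have keep: "s2 ''sel'' = s1 ''sel''" "s3 ''ker'' = s2 ''ker''" "s4 ''ker'' = s2 ''ker''" "s4 ''par'' = s3 ''par''"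
    by (auto simp: s2_def s3_def s4_def run_frame)
  have r: "r < N" using pass_ctxD(3)[OF s] .
  define Q where "Q = {v. v < N \<and> 0 < s2 ''ker'' v}"
  define p where "p = s3 ''par''"
  define wit where "wit = s4 ''wit''"
  have layer_lt: "v < N" if "v \<in> layer E r f x" for v x
    using that scc_lt[OF _ r] by (auto simp: layer_def)
  have layer_eq: "layer E r f v = layer E r f x" if "v \<in> layer E r f x" for v x
    using that by (auto simp: layer_def)
  have kernel: "indep (dir d E) (Q \<inter> layer E r f x)"
    "\<exists>t\<in>Q \<inter> layer E r f x. (x, t) \<notin> dir d E" if x: "x \<in> scc E r" for x
  proof -
    let ?X = "layer E r f x" and ?S = "{v. v < N \<and> 0 < s1 ''sel'' v}"
    have S: "v \<in> ?S \<longleftrightarrow> \<not> (\<exists>u\<in>?S \<inter> ?X. u < v \<and> (u, v) \<in> dir d E)" if "v \<in> ?X" for v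
    proof -
      have "(\<exists>u\<in>?S \<inter> ?X. u < v \<and> (u, v) \<in> dir d E) \<longleftrightarrow>
          (\<exists>u<v. 0 < s1 ''sel'' u \<and> u \<in> ?X \<and> (u, v) \<in> dir d E)"
        using less_trans[OF _ layer_lt[OF that]] by blast
      then show ?thesis
        using run_select_greedily[OF s layer_lt[OF that]] layer_lt[OF that]
        unfolding s1_def[symmetric] layer_eq[OF that] by simp
    qed
    have Q: "v \<in> Q \<longleftrightarrow> v \<in> ?S \<and> \<not> (\<exists>u\<in>Q \<inter> ?X. v < u \<and> (u, v) \<in> dir d E)" if "v \<in> ?X" for v
    proof -
      have "(\<exists>u\<in>Q \<inter> ?X. v < u \<and> (u, v) \<in> dir d E) \<longleftrightarrow>
          (\<exists>u<N. v < u \<and> 0 < s2 ''ker'' u \<and> u \<in> ?X \<and> (u, v) \<in> dir d E)"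
        unfolding Q_def by blast
      then show ?thesis
        using run_kernel[OF c(1) layer_lt[OF that]] layer_lt[OF that]
        unfolding s2_def[symmetric] layer_eq[OF that] by (simp add: Q_def)
    qed
    have "x \<in> ?X" using x by (simp add: layer_def)
    then show "indep (dir d E) (Q \<inter> ?X)" "\<exists>t\<in>Q \<inter> ?X. (x, t) \<notin> dir d E"
      using quasi_kernel[OF dir_free[OF free] S Q] by blast+
  qed
  have wit: "wit x \<in> Q \<inter> layer E r f x" "(x, wit x) \<notin> dir d E" if x: "x \<in> scc E r" for x
  proof -
    have "\<exists>u. u < N \<and> 0 < s3 ''ker'' u \<and> u \<in> layer E r f x \<and> (x, u) \<notin> dir d E"
      using kernel(2)[OF x] by (auto simp: Q_def keep)
    from run_witnesses(2)[OF c(3) scc_lt[OF x r] this] run_witnesses(1)[OF c(3) scc_lt[OF x r]]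
    show "wit x \<in> Q \<inter> layer E r f x" "(x, wit x) \<notin> dir d E"
      by (auto simp: wit_def s4_def Q_def keep)
  qed
  have par: "(p v, v) \<in> dir d E \<and> f (p v) = Suc (f v)" if v: "v \<in> scc E r" "v \<noteq> r" for v
  proof -
    have "v \<in> scc (dir d E) r" using v by simp
    then have "0 < f v" using is_levelD(3)[OF lev] by (auto simp: scc_def)
    from is_levelD(5)[OF lev this v(2)] show ?thesis
      using run_parents(2)[OF c(2) scc_lt[OF v(1) r]] by (simp add: p_def s3_def)
  qed
  have fin: "finite (layer E r f x)" for x
    by (rule finite_subset[of _ "{..<N}"]) (use layer_lt[of _ x] in blast, simp)
  have "pass_ok (dir d E) N r f p Q wit"
    unfolding pass_ok_def using lev par kernel(1) fin wit by simp
  moreover have "run (pass d) s (label_array d) v = pass_label (dir d E) r f p Q wit v" if "v \<in> scc E r" for v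
  proof -
    have v: "v < N" using scc_lt[OF that r] .
    have f: "f v \<le> Suc N" using is_levelD(1,2)[OF lev] by (cases "v = r") (auto simp: le_SucI)
    have "run (label d) s4 (label_array d) v =
        pass_label (dir d E) r f (s4 ''par'') {v. v < N \<and> 0 < s4 ''ker'' v} (s4 ''wit'') v"
      by (rule run_label[OF c(4) v f])
         (simp_all add: keep, simp_all add: s4_def s3_def run_witnesses(1)[OF c(3)[unfolded s3_def]] run_parents(1)[OF c(2)])
    then show ?thesis
      by (simp add: pass_def s1_def[symmetric] s2_def[symmetric] s3_def[symmetric] s4_def[symmetric]
        keep Q_def p_def wit_def)
  qed
  ultimately show ?thesis by blast
qed

lemma run_component:
  assumes free: "C3_free_rel E" and s: "base s" "s ''r'' 0 = r" "r < N"
  shows "base (run component s)" "labelled_from E N r (run component s ''lab'')"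
    "v < N \<Longrightarrow> v \<notin> scc E r \<Longrightarrow> run component s ''lab'' v = s ''lab'' v"
proof -
  define s1 where "s1 = run (levels True ''lf'') s"
  define s2 where "s2 = run (levels False ''lb'') s1"
  define s3 where "s3 = run (pass True) s2"
  define s4 where "s4 = run (pass False) s3"
  have run: "run component s = run relabel s4"
    by (simp add: component_def s1_def s2_def s3_def s4_def)
  show "base (run component s)"
    using s(1) by (simp add: base_def run_frame writes_component)
  define f g where "f = bfs E r N" and "g = bfs (E\<inverse>) r N"
  have lev: "is_level E N r f" "is_level (E\<inverse>) N r g"
    using bfs_is_level[OF dir_E_sub[of True] s(3)] bfs_is_level[OF dir_E_sub[of False] s(3)]
    by (simp_all add: f_def g_def)
  have s1: "base s1" "s1 ''r'' 0 = r" using s by (simp_all add: s1_def base_def run_frame)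
  have lf: "s2 ''lf'' v = f v" and lb: "s2 ''lb'' v = g v" if "v < N" for v
    using run_levels[OF s(1,2) _ that, of "''lf''" True] run_levels[OF s1 _ that, of "''lb''" False]
    by (simp_all add: s2_def s1_def run_frame f_def g_def)
  have scc: "0 < f v \<and> 0 < g v \<longleftrightarrow> v \<in> scc E r" for v
    using is_levelD(3)[OF lev(1), of v] is_levelD(3)[OF lev(2), of v]
    by (simp add: scc_def rtrancl_converse)
  have base2: "base s2" "s2 ''r'' 0 = r" using s1 by (simp_all add: s2_def base_def run_frame)
  have ctx: "pass_ctx True r f s2" "pass_ctx False r g s2"
    unfolding pass_ctx_def level_array_def using base2 s(3) lf lb scc by auto
  have ctx3: "pass_ctx False r g s3"
    using ctx(2) by (rule pass_ctx_frame) (auto simp: s3_def run_frame label_array_def)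
  obtain p Q wit where P: "pass_ok E N r f p Q wit"
    "\<forall>v\<in>scc E r. s3 ''pf'' v = pass_label E r f p Q wit v"
    using run_pass[OF free ctx(1)] lev(1) by (auto simp: s3_def label_array_def)
  obtain p' Q' wit' where P': "pass_ok (E\<inverse>) N r g p' Q' wit'"
    "\<forall>v\<in>scc E r. s4 ''pb'' v = pass_label (E\<inverse>) r g p' Q' wit' v"
    using run_pass[OF free ctx3] lev(2) by (auto simp: s4_def label_array_def)
  have keep: "s4 ''pf'' = s3 ''pf''" "s4 ''lf'' = s2 ''lf''" "s4 ''lb'' = s2 ''lb''" "s4 ''lab'' = s ''lab''"
    "s4 ''n'' = s ''n''"
    by (simp_all add: s4_def s3_def s2_def s1_def run_frame label_array_def)
  have lab: "run relabel s4 ''lab'' v = (if v \<in> scc E r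
      then if f v = N then s4 ''pb'' v + 1 else s3 ''pf'' v else s ''lab'' v)" if v: "v < N" for v
    unfolding relabel_def
    by (subst run_Fill) (use s(1) v scc[of v] lf[OF v] lb[OF v] in \<open>auto simp: keep base_def\<close>)
  show "run component s ''lab'' v = s ''lab'' v" if "v < N" "v \<notin> scc E r"
    using lab[OF that(1)] that(2) by (simp add: run)
  show "labelled_from E N r (run component s ''lab'')"
    unfolding labelled_from_def run using P P' lab scc_lt[OF _ s(3)] by (intro exI conjI) auto
qed

text \<open>Components are disjoint, so labelling the component of one vertex leaves the labels of the other components
consistent.\<close>

lemma run_all_components:
  assumes free: "C3_free_rel E" and s: "base s"
  defines "s' \<equiv> run (Loop ''r'' component) s"
  shows "base s'" "v < N \<Longrightarrow> \<exists>r<N. v \<in> scc E r \<and> labelled_from E N r (s' ''lab'')"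
proof -
  define I where "I k t \<longleftrightarrow> base t \<and> (\<forall>v<N. (\<exists>j<k. j \<in> scc E v) \<longrightarrow>
    (\<exists>r<N. v \<in> scc E r \<and> labelled_from E N r (t ''lab'')))" for k t
  have "I N s'"
    unfolding s'_def
  proof (rule run_Loop_inv)
    fix k t assume k: "k < N" and I: "I k t"
    let ?t = "set_var t ''r'' k"
    have b: "base ?t" "?t ''r'' 0 = k" using I by (simp_all add: I_def base_def)
    note c = run_component[OF free b k]
    have "\<exists>r<N. v \<in> scc E r \<and> labelled_from E N r (run component ?t ''lab'')"
      if v: "v < N" and j: "\<exists>j<Suc k. j \<in> scc E v" for v
    proof (cases "v \<in> scc E k")
      case True
      then show ?thesis using c(2) k by blast
    next
      case False
      then have "k \<notin> scc E v" by (metis scc_eq scc_refl)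
      then have "\<exists>j<k. j \<in> scc E v" using j less_Suc_eq by metis
      then obtain r where r: "r < N" "v \<in> scc E r" "labelled_from E N r (t ''lab'')"
        using I v unfolding I_def by blast
      have "run component ?t ''lab'' x = t ''lab'' x" if x: "x \<in> scc E r" for x
      proof -
        have "x \<notin> scc E k" using False r(2) x by (metis scc_eq)
        from c(3)[OF scc_lt[OF x r(1)] this] have "run component ?t ''lab'' x = ?t ''lab'' x" .
        then show ?thesis by (simp only: set_var_apply) simp
      qed
      then have "labelled_from E N r (run component ?t ''lab'')"
        by (rule labelled_from_cong[OF r(3)])
      then show ?thesis using r by blast
    qed
    then show "I (Suc k) (run component ?t)" unfolding I_def using c(1) by blast
  qed (use s in \<open>simp_all add: I_def base_def\<close>)
  then show "base s'" by (simp add: I_def)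
  assume v: "v < N"
  then have "\<exists>j<N. j \<in> scc E v" by (intro exI[of _ v]) simp
  then show "\<exists>r<N. v \<in> scc E r \<and> labelled_from E N r (s' ''lab'')"
    using v \<open>I N s'\<close> by (simp add: I_def)
qed

lemma run_refine_round:
  assumes free: "C3_free_rel E" and s: "base s"
  shows "\<exists>lab. (\<forall>v<N. \<exists>r<N. v \<in> scc E r \<and> labelled_from E N r lab) \<and>
    (\<forall>u<N. \<forall>v<N. run refine_round s ''colour'' u = run refine_round s ''colour'' v \<longleftrightarrow> C u = C v \<and> lab u = lab v)"
    "run refine_round s ''n'' 0 = N" "run refine_round s ''adj'' = A"
proof -
  let ?P = "AndE (EqE (Rd ''colour'' (Var ''u'')) (Rd ''colour'' (Var ''v'')))
       (EqE (Rd ''lab'' (Var ''u'')) (Rd ''lab'' (Var ''v'')))"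
  define s1 where "s1 = run (Loop ''r'' component) s"
  define s2 where "s2 = run (Search ''rep'' ?P) s1"
  have run: "run refine_round s = run (Fill ''colour'' (Rd ''rep'' (Var ''v''))) s2"
    by (simp add: refine_round_def s1_def s2_def)
  show "run refine_round s ''n'' 0 = N" "run refine_round s ''adj'' = A"
  proof -
    have "''n'' \<notin> writes refine_round" "''adj'' \<notin> writes refine_round"
      by (simp_all add: refine_round_def writes_component)
    from this[THEN run_frame] show "run refine_round s ''n'' 0 = N" "run refine_round s ''adj'' = A"
      using s by (simp_all add: base_def)
  qed
  have b: "base s1" using run_all_components(1)[OF free s] by (simp add: s1_def)
  then have n: "s1 ''n'' 0 = N" and n2: "s2 ''n'' 0 = N" by (simp_all add: base_def s2_def run_frame)
  define lab where "lab = s1 ''lab''"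
  define R where "R u v \<longleftrightarrow> C u = C v \<and> lab u = lab v" for u v
  have "run (Search ''rep'' ?P) s1 ''rep'' v =
      (if \<exists>u<s1 ''n'' 0. R u v then Max {u. u < s1 ''n'' 0 \<and> R u v} else 0)" if "v < N" for v
  proof (rule run_Search[where R = R])
    fix s' :: state
    assume fr: "\<And>y. y \<notin> {''v'', ''buf'', ''u'', ''rep''} \<Longrightarrow> s' y = s1 y"
    have "s' ''colour'' = C" "s' ''lab'' = lab" using fr[of "''colour''"] fr[of "''lab''"] b
      by (simp_all add: base_def lab_def)
    then show "0 < heval ?P s' \<longleftrightarrow> R (s' ''u'' 0) (s' ''v'' 0)" by (simp add: R_def)
  qed (use that n in auto)
  then have rep: "s2 ''rep'' v = Max {u. u < N \<and> R u v}" if "v < N" for v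
    using that unfolding s2_def n R_def by auto
  have col: "run refine_round s ''colour'' v = Max {u. u < N \<and> R u v}" if "v < N" for v
    unfolding run by (subst run_Fill) (use that rep n2 in auto)
  have "run refine_round s ''colour'' u = run refine_round s ''colour'' v \<longleftrightarrow> R u v" if uv: "u < N" "v < N" for u v
  proof
    assume "R u v"
    then have "{w. w < N \<and> R w u} = {w. w < N \<and> R w v}" by (auto simp: R_def)
    then show "run refine_round s ''colour'' u = run refine_round s ''colour'' v" using col uv by simp
  next
    assume "run refine_round s ''colour'' u = run refine_round s ''colour'' v"
    then have eq: "Max {w. w < N \<and> R w u} = Max {w. w < N \<and> R w v}" using col uv by simp
    have "\<exists>w<N. R w u" "\<exists>w<N. R w v" using uv by (auto simp: R_def)
    then have "R (Max {w. w < N \<and> R w u}) u" "R (Max {w. w < N \<and> R w v}) v"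
      using Max_choice(2)[of N "\<lambda>w. R w u"] Max_choice(2)[of N "\<lambda>w. R w v"] by simp_all
    then show "R u v" unfolding eq by (simp add: R_def)
  qed
  then show "\<exists>lab. (\<forall>v<N. \<exists>r<N. v \<in> scc E r \<and> labelled_from E N r lab) \<and>
    (\<forall>u<N. \<forall>v<N. run refine_round s ''colour'' u = run refine_round s ''colour'' v \<longleftrightarrow> C u = C v \<and> lab u = lab v)"
    using run_all_components(2)[OF free s] unfolding R_def lab_def s1_def by blast
qed

end

text \<open>Invariant after \<open>i\<close> rounds: the components of the colour classes have independence number at most
\<open>max 1 (a - i)\<close>, and the number of colours is at most the product of the first \<open>i\<close> palettes. Since
\<open>a \<le> n\<close>, all components are single vertices after \<open>n\<close> rounds.\<close>

theorem algorithm_correct: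
  fixes A :: "nat \<Rightarrow> nat" and n :: nat and s :: state
  defines "E0 \<equiv> colour_arcs n A (\<lambda>_. 0)"
  assumes free: "C3_free_rel E0" and \<alpha>: "\<And>S. S \<subseteq> {..<n} \<Longrightarrow> indep E0 S \<Longrightarrow> card S \<le> \<alpha>"
    and s: "s ''n'' 0 = n" "s ''adj'' = A" "s ''colour'' = (\<lambda>_. 0)"
  defines "C \<equiv> run algorithm s ''colour''"
  shows "acyclic (colour_arcs n A C)" "card (C ` {..<n}) \<le> 12 ^ (\<alpha> - 1) * fact \<alpha>"
proof -
  \<comment> \<open>\<open>\<alpha>\<close> may exceed the number of rounds, but no independent set has more than \<open>n\<close> elements\<close>
  define a where "a = min \<alpha> n"
  have card_le_a: "card S \<le> a" if "S \<subseteq> {..<n}" "indep E0 S" for S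
    using \<alpha>[OF that] card_mono[OF _ that(1)] by (simp add: a_def)
  have free': "C3_free_rel (colour_arcs n A C)" for C
    by (rule C3_free_rel_subset[OF free]) (auto simp: E0_def colour_arcs_def)
  define J where "J i t \<longleftrightarrow> t ''n'' 0 = n \<and> t ''adj'' = A \<and>
    (\<forall>v<n. \<forall>S. finite S \<longrightarrow> S \<subseteq> scc (colour_arcs n A (t ''colour'')) v \<longrightarrow>
      indep (colour_arcs n A (t ''colour'')) S \<longrightarrow> card S \<le> max 1 (a - i)) \<and>
    card (t ''colour'' ` {..<n}) \<le> (\<Prod>j<i. palette (a - j))" for i t
  have "J n (run algorithm s)"
    unfolding algorithm_def
  proof (rule run_Loop_inv)
    interpret round_context n A "\<lambda>_. 0" .
    have "S \<subseteq> {..<n}" if "v < n" "S \<subseteq> scc E0 v" for v S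
      using scc_lt[OF _ that(1)] that(2) by (auto simp: E0_def)
    then have "card S \<le> max 1 a" if "v < n" "S \<subseteq> scc E0 v" "indep E0 S" for v S
      using card_le_a that by (meson le_max_iff_disj)
    moreover have "card ((\<lambda>_. 0 :: nat) ` {..<n}) \<le> 1"
      using card_mono[of "{0 :: nat}" "(\<lambda>_. 0) ` {..<n}"] by auto
    ultimately show "J 0 s" using s unfolding J_def E0_def by simp
  next
    fix i t assume "i < n" and J: "J i t"
    let ?t = "set_var t ''i'' i"
    define C where "C = t ''colour''"
    define C' where "C' = run refine_round ?t ''colour''"
    interpret round_context n A C .
    have base: "base ?t" unfolding base_def using J by (simp add: J_def C_def)
    have bound: "card S \<le> max 1 (a - i)" if "v < n" "finite S" "S \<subseteq> scc E v" "indep E S" for v S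
      using J that unfolding J_def C_def by blast
    obtain lab where lab: "\<And>v. v < n \<Longrightarrow> \<exists>r<n. v \<in> scc E r \<and> labelled_from E n r lab"
      and C': "\<And>u v. u < n \<Longrightarrow> v < n \<Longrightarrow> C' u = C' v \<longleftrightarrow> C u = C v \<and> lab u = lab v"
      using run_refine_round(1)[OF free' base] unfolding C'_def by blast
    have F: "colour_arcs n A C' = {(x, y) \<in> E. lab x = lab y}"
      using C' by (auto simp: colour_arcs_def)
    have "card S \<le> max 1 (a - Suc i)"
      if v: "v < n" and S: "finite S" "S \<subseteq> scc (colour_arcs n A C') v" "indep (colour_arcs n A C') S" for v S
    proof -
      obtain r where r: "r < n" "v \<in> scc E r" "labelled_from E n r lab" using lab[OF v] by blast
      obtain f p Q wit f' p' Q' wit' where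
        ok: "pass_ok E n r f p Q wit" "pass_ok (E\<inverse>) n r f' p' Q' wit'" and
        l: "\<And>x. x \<in> scc E r \<Longrightarrow> lab x = (if f x = n then pass_label (E\<inverse>) r f' p' Q' wit' x + 1
                            else pass_label E r f p Q wit x)"
        using r(3) unfolding labelled_from_def by blast
      have "card S \<le> max 1 (max 1 (a - i) - 1)"
        by (rule refinement_round[OF free' ok l bound[OF r(1)] r(2) F S])
      then show ?thesis by simp
    qed
    moreover have "card (C' ` {..<n}) \<le> (\<Prod>j<Suc i. palette (a - j))"
    proof -
      have "card (C' ` {..<n}) = card ((\<lambda>v. (C v, lab v)) ` {..<n})"
        using C' by (intro card_image_eq_of_same_kernel) auto
      also have "\<dots> \<le> card (C ` {..<n} \<times> lab ` {..<n})"
        by (rule card_mono) auto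
      also have "\<dots> = card (C ` {..<n}) * card (lab ` {..<n})" by (rule card_cartesian_product)
      also have "\<dots> \<le> (\<Prod>j<i. palette (a - j)) * palette (a - i)"
        using J card_labels[OF free' lab bound] by (intro mult_le_mono) (simp_all add: J_def C_def)
      finally show ?thesis by simp
    qed
    ultimately show "J (Suc i) (run refine_round ?t)"
      using run_refine_round(2,3)[OF free' base] unfolding J_def C'_def by blast
  qed (rule s)
  note J = this[unfolded J_def C_def[symmetric]]
  have "a - n = 0" by (simp add: a_def)
  then have "scc (colour_arcs n A C) v = {v}" if "v < n" for v
    using J that by (intro scc_trivial[OF free']) auto
  then show "acyclic (colour_arcs n A C)"
    by (intro acyclic_of_trivial_sccs[OF free']) (auto simp: colour_arcs_def)
  have "card (C ` {..<n}) \<le> 12 ^ (a - 1) * fact a"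
    using J palette_product[of a n] by linarith
  also have "\<dots> \<le> 12 ^ (\<alpha> - 1) * fact \<alpha>"
    by (intro mult_mono power_increasing fact_mono diff_le_mono) (auto simp: a_def)
  finally show "card (C ` {..<n}) \<le> 12 ^ (\<alpha> - 1) * fact \<alpha>" .
qed

section \<open>Digraphs\<close>

lemma acyclic_map:
  assumes "acyclic S" "\<And>x y. (x, y) \<in> R \<Longrightarrow> (g x, g y) \<in> S"
  shows "acyclic R"
proof (rule acyclicI, intro allI notI)
  fix x assume "(x, x) \<in> R\<^sup>+"
  have "(g x, g y) \<in> S\<^sup>+" if "(x, y) \<in> R\<^sup>+" for x y
    using that by (induction rule: trancl_induct) (auto intro: assms(2) trancl.intros)
  then show False using \<open>(x, x) \<in> R\<^sup>+\<close> assms(1) by (auto simp: acyclic_def)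
qed

lemma independent_set_iff_indep:
  "independent_set D S \<longleftrightarrow> S \<subseteq> verts D \<and> indep (arcs_ends D) S"
  by (auto simp: independent_set_def indep_def parcs_mk_symmetric arcs_ends_conv)

lemma indep_card_le_independence_number:
  assumes "finite (verts D)" "S \<subseteq> verts D" "indep (arcs_ends D) S"
  shows "card S \<le> independence_number D"
  unfolding independence_number_def
proof (rule Max_ge)
  have "{card S | S. independent_set D S} \<subseteq> card ` Pow (verts D)"
    by (auto simp: independent_set_def)
  then show "finite {card S | S. independent_set D S}"
    by (rule finite_subset) (use assms(1) in simp)
qed (use assms in \<open>auto simp: independent_set_iff_indep\<close>)

text \<open>There are no 2-cycles and no parallel arcs, so the subgraph induced by the vertices of a directed triangle
has no arcs besides the three of the triangle.\<close>

lemma C3_free_imp_C3_free_rel: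
  assumes "oriented_digraph D" "C3_free D"
  shows "C3_free_rel (arcs_ends D)"
proof -
  interpret oriented_digraph D by fact
  have asym: "asym (arcs_ends D)" using no_2cycle by (auto simp: asym_iff)
  have False if uvw: "(u, v) \<in> arcs_ends D" "(v, w) \<in> arcs_ends D" "(w, u) \<in> arcs_ends D" for u v w
  proof -
    have neq: "u \<noteq> v" "v \<noteq> w" "w \<noteq> u" using uvw adj_not_same by blast+
    obtain e1 e2 e3 where e1: "e1 \<in> arcs D" "tail D e1 = u" "head D e1 = v"
      and e2: "e2 \<in> arcs D" "tail D e2 = v" "head D e2 = w"
      and e3: "e3 \<in> arcs D" "tail D e3 = w" "head D e3 = u"
      using uvw by (meson reachableE)
    define H where "H = D \<restriction> {u, v, w}"
    have uvw_verts: "{u, v, w} \<subseteq> verts D" using uvw adj_in_verts by blast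
    have arc_cases: "e = e1 \<or> e = e2 \<or> e = e3" if e: "e \<in> arcs D" "tail D e \<in> {u, v, w}" "head D e \<in> {u, v, w}" for e
    proof -
      have te: "(tail D e, head D e) \<in> arcs_ends D" using e(1) by (auto simp: arcs_ends_conv)
      then have "(tail D e, head D e) \<in> {(u, v), (v, w), (w, u)}"
        using e(2,3) uvw no_2cycle adj_not_same by fastforce
      then show ?thesis
        using no_multi_arcs[OF e(1) e1(1)] no_multi_arcs[OF e(1) e2(1)] no_multi_arcs[OF e(1) e3(1)] e1 e2 e3
        by (auto simp: arc_to_ends_def)
    qed
    have arcsH: "arcs H = {e1, e2, e3}"
      using arc_cases e1 e2 e3 by (auto simp: H_def)
    have vertsH: "verts H = {u, v, w}" by (simp add: H_def)
    have e_neq: "e1 \<noteq> e2" "e2 \<noteq> e3" "e3 \<noteq> e1" using e1 e2 e3 neq by auto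
    have "induced_subgraph H D" unfolding H_def by (rule induced_induce[OF uvw_verts])
    moreover have "digraph_iso H C3"
    proof -
      define f :: "('a, 'b, nat, nat \<times> nat) digraph_isomorphism" where
        "f = \<lparr>iso_verts = (\<lambda>x. if x = u then 0 else if x = v then 1 else 2),
              iso_arcs = (\<lambda>e. if e = e1 then (0, 1) else if e = e2 then (1, 2) else (2, 0)),
              iso_head = snd, iso_tail = fst\<rparr>"
      have wf: "wf_digraph H" unfolding H_def by (rule wf_digraphI_induced[OF induced_induce[OF uvw_verts]])
      have "pre_digraph.digraph_isomorphism H f"
        unfolding pre_digraph.digraph_isomorphism_def
        using wf arcsH e1 e2 e3 neq e_neq by (auto simp: f_def H_def inj_on_def)
      moreover have "C3 = app_iso f H"
        unfolding app_iso_def C3_def vertsH arcsH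
        using neq e_neq neq[symmetric] e_neq[symmetric] by (simp add: f_def insert_commute)
      ultimately show ?thesis unfolding digraph_iso_def by blast
    qed
    ultimately show False using assms(2) unfolding C3_free_def by blast
  qed
  then show ?thesis using asym unfolding C3_free_rel_def by blast
qed

lemma acyclic_setI:
  assumes X: "X \<subseteq> verts D" and ac: "acyclic (arcs_ends D \<inter> X \<times> X)"
  shows "acyclic_set D X"
  unfolding acyclic_set_def
proof (intro conjI X notI)
  assume "\<exists>p. pre_digraph.cycle (D \<restriction> X) p"
  then obtain p u where p: "pre_digraph.awalk (D \<restriction> X) u p u" "p \<noteq> []"
    unfolding pre_digraph.cycle_def by blast
  let ?R = "arcs_ends D \<inter> X \<times> X"
  have path: "(x, y) \<in> ?R\<^sup>*" if "pre_digraph.cas (D \<restriction> X) x q y" "set q \<subseteq> arcs (D \<restriction> X)" for x q y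
    using that
  proof (induction q arbitrary: x)
    case Nil
    then show ?case by (simp add: pre_digraph.cas.simps)
  next
    case (Cons e q)
    then have "(head D e, y) \<in> ?R\<^sup>*" "(x, head D e) \<in> ?R"
      by (auto simp: pre_digraph.cas.simps arcs_ends_conv)
    then show ?case by (meson converse_rtrancl_into_rtrancl)
  qed
  obtain e q where q: "p = e # q" using p(2) by (cases p) auto
  have "(u, head D e) \<in> ?R" "(head D e, u) \<in> ?R\<^sup>*"
    using p(1) path[of "head D e" q u] unfolding q pre_digraph.awalk_def
    by (auto simp: pre_digraph.cas.simps arcs_ends_conv)
  then have "(u, u) \<in> ?R\<^sup>+" by (rule rtrancl_into_trancl2)
  then show False using ac by (simp add: acyclic_def)
qed

lemma colouring_acyclic_partition:
  assumes ac: "acyclic {(u, v) \<in> arcs_ends D. f u = f v}"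
  defines "P \<equiv> {{v \<in> verts D. f v = f u} | u. u \<in> verts D}"
  shows "acyclic_partition D P" "card P = card (f ` verts D)"
proof -
  have "partition_on (verts D) P"
    by (rule partition_onI) (auto simp: P_def disjnt_def)
  moreover have "acyclic_set D X" if "X \<in> P" for X
  proof (rule acyclic_setI)
    show "X \<subseteq> verts D" using that by (auto simp: P_def)
    show "acyclic (arcs_ends D \<inter> X \<times> X)"
      by (rule acyclic_subset[OF ac]) (use that in \<open>auto simp: P_def\<close>)
  qed
  ultimately show "acyclic_partition D P" by (simp add: acyclic_partition_def)
  have "P = (\<lambda>c. {v \<in> verts D. f v = c}) ` f ` verts D" by (auto simp: P_def)
  moreover have "inj_on (\<lambda>c. {v \<in> verts D. f v = c}) (f ` verts D)" by (auto simp: inj_on_def)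
  ultimately show "card P = card (f ` verts D)" by (simp add: card_image)
qed

text \<open>With a constant colouring the arcs inside colour classes are all arcs of the digraph. Only the
truth values of the first \<open>n\<^sup>2\<close> cells matter.\<close>

lemma matrix_arcs:
  assumes "R \<subseteq> {..<n} \<times> {..<n}" "\<And>i. i < n * n \<Longrightarrow> 0 < A i \<longleftrightarrow> (i div n, i mod n) \<in> R"
  shows "colour_arcs n A (\<lambda>_. 0) = R"
proof -
  have "0 < A (n * u + v) \<longleftrightarrow> (u, v) \<in> R" if "u < n" "v < n" for u v
  proof -
    have "n * u + v < n * Suc u" using that by simp
    also have "\<dots> \<le> n * n" using that by (intro mult_le_mono) auto
    finally show ?thesis using assms(2)[of "n * u + v"] that by simp
  qed
  then show ?thesis using assms(1) by (auto simp: colour_arcs_def)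
qed

text \<open>The program is used here merely as a function on states; its execution on the machine is not involved.\<close>

lemma relation_colouring_exists:
  assumes R: "R \<subseteq> {..<n} \<times> {..<n}" and free: "C3_free_rel R"
    and \<alpha>: "\<And>S. S \<subseteq> {..<n} \<Longrightarrow> indep R S \<Longrightarrow> card S \<le> \<alpha>"
  shows "\<exists>C :: nat \<Rightarrow> nat. acyclic {(u, v) \<in> R. C u = C v} \<and> card (C ` {..<n}) \<le> 12 ^ (\<alpha> - 1) * fact \<alpha>"
proof -
  define A :: "nat \<Rightarrow> nat" where "A i = of_bool ((i div n, i mod n) \<in> R)" for i
  have A: "colour_arcs n A (\<lambda>_. 0) = R" using R by (rule matrix_arcs) (simp add: A_def)
  define s :: state where "s = (\<lambda>x i. 0)(''n'' := (\<lambda>_. n), ''adj'' := A)"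
  define C where "C = run algorithm s ''colour''"
  have "colour_arcs n A C = {(u, v) \<in> R. C u = C v}"
    unfolding A[symmetric] by (auto simp: colour_arcs_def)
  then show ?thesis
    using algorithm_correct[of n A \<alpha> s] free \<alpha> by (intro exI[of _ C]) (simp add: A s_def C_def)
qed

lemma colour_bound: "12 ^ (\<alpha> - 1) * fact \<alpha> \<le> 35 ^ (\<alpha> - 1) * (fact \<alpha> :: nat)"
  by (intro mult_right_mono power_mono) auto

text \<open>The vertices are renamed to \<open>0, \<dots>, n - 1\<close> and the colouring of the renamed digraph is pulled back.\<close>

lemma chromatic_number_bound:
  assumes D: "oriented_digraph D" "C3_free D" and \<alpha>: "independence_number D \<le> \<alpha>"
  shows "chromatic_number D \<le> 35 ^ (\<alpha> - 1) * fact \<alpha>"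
proof -
  interpret oriented_digraph D by fact
  obtain g where g: "bij_betw g (verts D) {..<card (verts D)}"
    using ex_bij_betw_finite_nat[OF finite_verts] by (auto simp: atLeast0LessThan)
  define n where "n = card (verts D)"
  define R where "R = (\<lambda>(u, v). (g u, g v)) ` arcs_ends D"
  note gn = g[folded n_def]
  have inj: "g u = g v \<longleftrightarrow> u = v" if "u \<in> verts D" "v \<in> verts D" for u v
    using that gn by (auto simp: bij_betw_def inj_on_def)
  have R_iff: "(g u, g v) \<in> R \<longleftrightarrow> (u, v) \<in> arcs_ends D" if "u \<in> verts D" "v \<in> verts D" for u v
  proof
    assume "(g u, g v) \<in> R"
    then obtain x y where xy: "(x, y) \<in> arcs_ends D" "g u = g x" "g v = g y" by (auto simp: R_def)
    then show "(u, v) \<in> arcs_ends D"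
      using inj[OF that(1) adj_in_verts(1)[OF xy(1)]] inj[OF that(2) adj_in_verts(2)[OF xy(1)]] by simp
  qed (auto simp: R_def)
  have R_sub: "R \<subseteq> {..<n} \<times> {..<n}"
    using gn adj_in_verts by (auto simp: R_def bij_betw_def)
  have pre: "\<exists>u\<in>verts D. g u = i" if "i < n" for i
  proof -
    have "i \<in> g ` verts D" using that gn by (simp add: bij_betw_def)
    then show ?thesis by auto
  qed
  note freeD = C3_free_imp_C3_free_rel[OF D]
  have free: "C3_free_rel R"
    unfolding C3_free_rel_def asym_iff
  proof (intro conjI allI impI notI)
    fix x y assume xy: "(x, y) \<in> R" "(y, x) \<in> R"
    then have "x < n" "y < n" using R_sub by auto
    then obtain u v where "u \<in> verts D" "v \<in> verts D" "g u = x" "g v = y" using pre by blast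
    then show False using xy R_iff C3_free_relD(2)[OF freeD] by blast
  next
    fix x y z assume xyz: "(x, y) \<in> R" "(y, z) \<in> R" "(z, x) \<in> R"
    then have "x < n" "y < n" "z < n" using R_sub by auto
    then obtain u v w where "u \<in> verts D" "v \<in> verts D" "w \<in> verts D" "g u = x" "g v = y" "g w = z"
      using pre by meson
    then show False using xyz R_iff C3_free_relD(3)[OF freeD] by blast
  qed
  have "card S \<le> \<alpha>" if S: "S \<subseteq> {..<n}" "indep R S" for S
  proof -
    define S' where "S' = {u \<in> verts D. g u \<in> S}"
    have "indep (arcs_ends D) S'" using S(2) R_iff by (auto simp: indep_def S'_def)
    then have le: "card S' \<le> \<alpha>"
      using indep_card_le_independence_number[of D S'] \<alpha> by (simp add: S'_def)
    have "S = g ` S'" using pre S(1) unfolding S'_def by fastforce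
    moreover have "finite S'" by (simp add: S'_def)
    ultimately have "card S \<le> card S'" using card_image_le by metis
    then show ?thesis using le by simp
  qed
  from relation_colouring_exists[OF R_sub free this] obtain C :: "nat \<Rightarrow> nat" where
    C: "acyclic {(u, v) \<in> R. C u = C v}" "card (C ` {..<n}) \<le> 12 ^ (\<alpha> - 1) * fact \<alpha>"
    by blast
  define f where "f = C \<circ> g"
  have ac: "acyclic {(u, v) \<in> arcs_ends D. f u = f v}"
    by (rule acyclic_map[OF C(1), where g = g]) (auto simp: R_iff adj_in_verts f_def)
  have "chromatic_number D \<le> card (f ` verts D)"
    unfolding chromatic_number_def
    by (rule Least_le, rule exI, rule conjI[OF colouring_acyclic_partition[OF ac]])
  also have "f ` verts D = C ` {..<n}"
    unfolding f_def image_comp[symmetric] bij_betw_imp_surj_on[OF gn] ..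
  finally have "chromatic_number D \<le> card (C ` {..<n})" .
  then show ?thesis using C(2) colour_bound[of \<alpha>] by linarith
qed

lemma algorithm_colours_digraph:
  fixes D :: "(nat, nat \<times> nat) pre_digraph"
  assumes D: "verts D = {..<n}" "oriented_digraph D" "C3_free D" "independence_number D \<le> \<alpha>"
  shows "\<exists>t s. exec (compile 0 algorithm) (input_state D n \<alpha>) t s \<and> t \<le> prog_time algorithm n \<and>
    acyclic_partition D (output_partition n s) \<and> card (output_partition n s) \<le> 35 ^ (\<alpha> - 1) * fact \<alpha>"
proof -
  interpret oriented_digraph D by fact
  define s0 where "s0 = input_state D n \<alpha>"
  define C where "C = run algorithm s0 ''colour''"
  have s0: "s0 ''n'' 0 = n" "s0 ''colour'' = (\<lambda>_. 0)" by (simp_all add: s0_def input_state_def)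
  have "arcs_ends D \<subseteq> {..<n} \<times> {..<n}" using adj_in_verts D(1) by auto
  then have A: "colour_arcs n (s0 ''adj'') (\<lambda>_. 0) = arcs_ends D"
    by (rule matrix_arcs) (simp add: s0_def input_state_def)
  have free: "C3_free_rel (colour_arcs n (s0 ''adj'') (\<lambda>_. 0))"
    unfolding A by (rule C3_free_imp_C3_free_rel[OF D(2,3)])
  have ind: "card S \<le> \<alpha>" if "S \<subseteq> {..<n}" "indep (colour_arcs n (s0 ''adj'') (\<lambda>_. 0)) S" for S
    using indep_card_le_independence_number[OF finite_verts, of S] that D(1,4) unfolding A by simp
  have C: "acyclic (colour_arcs n (s0 ''adj'') C)" "card (C ` {..<n}) \<le> 12 ^ (\<alpha> - 1) * fact \<alpha>"
    unfolding C_def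
    by (rule algorithm_correct[OF free _ s0(1) refl s0(2)]; rule ind; assumption)+
  have "colour_arcs n (s0 ''adj'') C = {(u, v) \<in> arcs_ends D. C u = C v}"
    unfolding A[symmetric] by (auto simp: colour_arcs_def)
  note P = colouring_acyclic_partition[OF C(1)[unfolded this]]
  obtain t s where ts: "exec (compile 0 algorithm) s0 t s" "t \<le> prog_time algorithm n"
    "\<forall>x. x \<noteq> ''t'' \<longrightarrow> s x = run algorithm s0 x"
    using compile_correct[where ?s0.0 = s0 and s = s0 and k = 0, OF compilable_algorithm s0(1)]
    unfolding terminates_def by blast
  have "s ''colour'' = C" using ts(3) by (simp add: C_def)
  then have classes: "output_partition n s = {{v \<in> verts D. C v = C u} | u. u \<in> verts D}"
    using D(1) by (simp add: output_partition_def)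
  have "card (output_partition n s) = card (C ` {..<n})" unfolding classes P(2) by (simp only: D(1))
  also have "\<dots> \<le> 35 ^ (\<alpha> - 1) * fact \<alpha>" using C(2) colour_bound by (rule le_trans)
  finally have "card (output_partition n s) \<le> 35 ^ (\<alpha> - 1) * fact \<alpha>" .
  then show ?thesis
    using P(1) ts(1,2) unfolding classes[symmetric] s0_def by (intro exI conjI)
qed

theorem theorem1p7:
  shows "(\<forall>\<alpha>\<ge>1. \<forall>D :: ('a, 'b) pre_digraph.
            oriented_digraph D \<and> C3_free D \<and> independence_number D \<le> \<alpha> \<longrightarrow>
            chromatic_number D \<le> 35 ^ (\<alpha> - 1) * fact \<alpha>)
       \<and> (\<exists>(c :: com) (p :: nat poly). \<forall>\<alpha>\<ge>1. \<forall>n. \<forall>D :: (nat, nat \<times> nat) pre_digraph.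
            verts D = {..<n} \<and> oriented_digraph D \<and> C3_free D \<and> independence_number D \<le> \<alpha> \<longrightarrow>
            (\<exists>t s. exec c (input_state D n \<alpha>) t s \<and> t \<le> poly p n \<and>
                   acyclic_partition D (output_partition n s) \<and>
                   card (output_partition n s) \<le> 35 ^ (\<alpha> - 1) * fact \<alpha>))"
proof
  show "\<forall>\<alpha>\<ge>1. \<forall>D :: ('a, 'b) pre_digraph.
            oriented_digraph D \<and> C3_free D \<and> independence_number D \<le> \<alpha> \<longrightarrow>
            chromatic_number D \<le> 35 ^ (\<alpha> - 1) * fact \<alpha>"
    using chromatic_number_bound by blast
  obtain p :: "nat poly" where p: "\<forall>n. prog_time algorithm n = poly p n"
    using prog_time_poly by blast
  show "\<exists>(c :: com) (p :: nat poly). \<forall>\<alpha>\<ge>1. \<forall>n. \<forall>D :: (nat, nat \<times> nat) pre_digraph.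
            verts D = {..<n} \<and> oriented_digraph D \<and> C3_free D \<and> independence_number D \<le> \<alpha> \<longrightarrow>
            (\<exists>t s. exec c (input_state D n \<alpha>) t s \<and> t \<le> poly p n \<and>
                   acyclic_partition D (output_partition n s) \<and>
                   card (output_partition n s) \<le> 35 ^ (\<alpha> - 1) * fact \<alpha>)"
    using algorithm_colours_digraph p by (intro exI[of _ "compile 0 algorithm"] exI[of _ p]) auto
qed

end
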